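(* Let $K\in\{\mathbb{R},\mathbb{C},\mathbb{H}\}$, let $d\ge 2$ and $q\in[1,2]$. Assume that there are real coefficients $a_0,a_1\ge 0$ and $a_k\le 0$ for $k\ge 2$ (finitely many of the $a_k$ nonzero, or infinitely many with the series converging for every $t\in[0,1]$) such that $$t^q\le h(t):=a_0+a_1t^2+\sum_{k\ge 2}a_kQ_{K,d}^{(k)}(t)\qquad\text{for all }t\in[0,1].$$ Then for any tight frame $\{y_1,\ldots,y_N\}$ in $K^d$ with frame constant $\frac Nd$, $$\sum_{i\ne j}|\langle y_i,y_j\rangle|^q\le N^2\left(\frac{a_1}{d}+a_0\right)-N\,h(1).$$
   Context: $K^d$ carries the Hermitian product $\langle x,y\rangle=x^*y$ ($x^*$ is the conjugate transpose; for $K=\mathbb{H}$, $K^d$ is a right vector space) and norm $|x|=\sqrt{\langle x,x\rangle}$. A tight frame in $K^d$ with frame constant $A$ is a finite multiset of vectors $v_1,\ldots,v_N\in K^d$ with $\sum_{i=1}^N|\langle x,v_i\rangle|^2=A|x|^2$ for all $x\in K^d$. The vectors need not have unit norm. Sums over $i\neq j$ are over ordered pairs of distinct indices. $Q_{K,d}^{(k)}$ denotes the zonal spherical function of $K\mathbb{P}^{d-1}$ in the variable $t=|\langle x,y\rangle|$: $Q_{K,d}^{(k)}(t)=P_k^{(\alpha,\beta)}(2t^2-1)/P_k^{(\alpha,\beta)}(1)$, where $P_k^{(\alpha,\beta)}$ is the Jacobi polynomial of degree $k$ (orthogonal on $[-1,1]$ with weight $(1-x)^\alpha(1+x)^\beta$)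 with $\alpha=(d-1)\frac{\dim_{\mathbb{R}}K}{2}-1$ and $\beta=\frac{\dim_{\mathbb{R}}K}{2}-1$. *)

theory Defs
  imports "HOL-Analysis.Analysis" "HOL-Computational_Algebra.Computational_Algebra"
begin

section \<open>Quaternions\<close>

datatype quat = Quat (qre: real) (qi: real) (qj: real) (qk: real)

lemma quat_eq_iff: "x = y \<longleftrightarrow> qre x = qre y \<and> qi x = qi y \<and> qj x = qj y \<and> qk x = qk y"
  using quat.expand by blast

instantiation quat :: division_ring
begin

definition "0 = Quat 0 0 0 0"
definition "1 = Quat 1 0 0 0"
definition "x + y = Quat (qre x + qre y) (qi x + qi y) (qj x + qj y) (qk x + qk y)"
definition "- x = Quat (- qre x) (- qi x) (- qj x) (- qk x)"
definition "(x::quat) - y = Quat (qre x - qre y) (qi x - qi y) (qj x - qj y) (qk x - qk y)"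
definition "x * y = Quat
  (qre x * qre y - qi x * qi y - qj x * qj y - qk x * qk y)
  (qre x * qi y + qi x * qre y + qj x * qk y - qk x * qj y)
  (qre x * qj y - qi x * qk y + qj x * qre y + qk x * qi y)
  (qre x * qk y + qi x * qj y - qj x * qi y + qk x * qre y)"
definition "inverse x =
  (let r = (qre x)\<^sup>2 + (qi x)\<^sup>2 + (qj x)\<^sup>2 + (qk x)\<^sup>2
   in Quat (qre x / r) (- qi x / r) (- qj x / r) (- qk x / r))"
definition "x div y = x * inverse (y::quat)"

lemmas quat_ring_defs =
  zero_quat_def one_quat_def plus_quat_def uminus_quat_def minus_quat_def times_quat_def

lemma quat_normsq_eq_0:
  "(qre x)\<^sup>2 + (qi x)\<^sup>2 + (qj x)\<^sup>2 + (qk x)\<^sup>2 = 0 \<longleftrightarrow> x = 0"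
  by (simp add: quat_eq_iff zero_quat_def add_nonneg_eq_0_iff)

instance
proof
  fix x y z :: quat
  show "x * y * z = x * (y * z)" "(x + y) * z = x * z + y * z" "x * (y + z) = x * y + x * z"
    by (simp_all add: quat_eq_iff quat_ring_defs algebra_simps)
  assume x: "x \<noteq> 0"
  define r where "r = (qre x)\<^sup>2 + (qi x)\<^sup>2 + (qj x)\<^sup>2 + (qk x)\<^sup>2"
  have r: "r \<noteq> 0"
    using x by (simp add: r_def quat_normsq_eq_0)
  have inv: "inverse x = Quat (qre x / r) (- qi x / r) (- qj x / r) (- qk x / r)"
    by (simp add: inverse_quat_def r_def Let_def)
  show "inverse x * x = 1" "x * inverse x = 1"
    using r by (simp_all add: quat_eq_iff inv quat_ring_defs field_simps)
      (simp_all add: r_def power2_eq_square)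
qed (simp_all add: quat_eq_iff quat_ring_defs inverse_quat_def divide_quat_def)

end

lemma quat_simps [simp]:
  "qre 0 = 0" "qi 0 = 0" "qj 0 = 0" "qk 0 = 0"
  "qre 1 = 1" "qi 1 = 0" "qj 1 = 0" "qk 1 = 0"
  "qre (x + y) = qre x + qre y" "qi (x + y) = qi x + qi y"
  "qj (x + y) = qj x + qj y" "qk (x + y) = qk x + qk y"
  "qre (- x) = - qre x" "qi (- x) = - qi x" "qj (- x) = - qj x" "qk (- x) = - qk x"
  "qre (x - y) = qre x - qre y" "qi (x - y) = qi x - qi y"
  "qj (x - y) = qj x - qj y" "qk (x - y) = qk x - qk y"
  by (simp_all add: quat_ring_defs)

instantiation quat :: real_algebra_1
begin

definition "scaleR r x = Quat (r * qre x) (r * qi x) (r * qj x) (r * qk x)"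

instance
  by standard (simp_all add: quat_eq_iff scaleR_quat_def times_quat_def algebra_simps)

end

instantiation quat :: "{real_inner, real_normed_div_algebra}"
begin

definition "inner x y = qre x * qre y + qi x * qi y + qj x * qj y + qk x * qk y"
definition "norm x = sqrt ((qre x)\<^sup>2 + (qi x)\<^sup>2 + (qj x)\<^sup>2 + (qk x)\<^sup>2)"
definition "sgn (x::quat) = x /\<^sub>R norm x"
definition "dist x y = norm (x - y :: quat)"
definition uniformity_quat_def [code del]:
  "(uniformity :: (quat \<times> quat) filter) = (INF e\<in>{0 <..}. principal {(x, y). dist x y < e})"
definition open_quat_def [code del]:
  "open (U :: quat set) \<longleftrightarrow> (\<forall>x\<in>U. eventually (\<lambda>(x', y). x' = x \<longrightarrow> y \<in> U) uniformity)"

instance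
proof
  fix x y z :: quat and r :: real
  show in1: "inner x x = 0 \<longleftrightarrow> x = 0"
    using quat_normsq_eq_0[of x] by (simp add: inner_quat_def power2_eq_square)
  show in2: "0 \<le> inner x x"
    by (simp add: inner_quat_def)
  show nrm: "norm x = sqrt (inner x x)"
    by (simp add: norm_quat_def inner_quat_def power2_eq_square)
  show "norm x = 0 \<longleftrightarrow> x = 0"
    using in1 nrm by simp
  show "inner x y = inner y x"
    by (simp add: inner_quat_def algebra_simps)
  show "inner (x + y) z = inner x z + inner y z" "inner (r *\<^sub>R x) y = r * inner x y"
    by (simp_all add: inner_quat_def scaleR_quat_def algebra_simps)
  show "norm (r *\<^sub>R x) = \<bar>r\<bar> * norm x"
    by (simp add: norm_quat_def scaleR_quat_def power_mult_distrib distrib_left [symmetric]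
        real_sqrt_mult)
  show "norm (x * y) = norm x * norm y"
    by (simp add: norm_quat_def times_quat_def real_sqrt_mult [symmetric] power2_eq_square algebra_simps)
  show "norm (x + y) \<le> norm x + norm y"
  proof -
    let ?A = "norm (qre x, qi x, qj x, qk x)"
    have "norm u = norm (qre u, qi u, qj u, qk u)" for u :: quat
      by (simp add: norm_quat_def norm_Pair add.assoc)
    moreover have "(qre (x + y), qi (x + y), qj (x + y), qk (x + y))
        = (qre x, qi x, qj x, qk x) + (qre y, qi y, qj y, qk y)"
      by simp
    ultimately show ?thesis
      by (metis norm_triangle_ineq)
  qed
qed (rule sgn_quat_def dist_quat_def uniformity_quat_def open_quat_def)+

end

instantiation quat :: euclidean_space
begin

definition "Basis = {Quat 1 0 0 0, Quat 0 1 0 0, Quat 0 0 1 0, Quat 0 0 0 1}"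

instance
proof
  show "inner u v = (if u = v then 1 else 0)" if "u \<in> Basis" "v \<in> Basis" for u v :: quat
    using that unfolding Basis_quat_def by (elim insertE emptyE; simp add: inner_quat_def)
  show "(\<forall>u\<in>Basis. inner x u = 0) \<longleftrightarrow> x = 0" for x :: quat
    by (simp add: Basis_quat_def inner_quat_def quat_eq_iff[of x])
qed (simp_all add: Basis_quat_def)

end

lemma DIM_quat [simp]: "DIM(quat) = 4"
  by (simp add: Basis_quat_def)


section \<open>Hermitian product and tight frames\<close>

text \<open>The axiom determines the conjugation: it forces
  \<open>hconj x = (norm x)\<^sup>2 x\<^sup>-\<^sup>1\<close> for \<open>x \<noteq> 0\<close>.\<close>

class hermitian_scalar = real_normed_div_algebra +
  fixes hconj :: "'a \<Rightarrow> 'a"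
  assumes hconj_mult_self: "hconj x * x = ((norm x)\<^sup>2) *\<^sub>R 1"

instantiation real :: hermitian_scalar
begin
definition "hconj (x::real) = x"
instance by standard (simp add: hconj_real_def power2_eq_square)
end

instantiation complex :: hermitian_scalar
begin
definition "hconj = cnj"
instance by standard (metis complex_norm_square hconj_complex_def mult.commute of_real_def)
end

instantiation quat :: hermitian_scalar
begin
definition "hconj x = Quat (qre x) (- qi x) (- qj x) (- qk x)"
instance
  by standard (simp add: hconj_quat_def quat_eq_iff scaleR_quat_def times_quat_def
      norm_quat_def power2_eq_square)
end

definition hinner :: "'k::hermitian_scalar ^ 'n \<Rightarrow> 'k ^ 'n \<Rightarrow> 'k" where
  "hinner x y = (\<Sum>i\<in>UNIV. hconj (x $ i) * y $ i)"

lemma hinner_self: "hinner x x = of_real ((norm x)\<^sup>2)"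
proof -
  have "(norm x)\<^sup>2 = (\<Sum>i\<in>UNIV. (norm (x $ i))\<^sup>2)"
    by (simp add: norm_vec_def L2_set_def sum_nonneg)
  then show ?thesis
    by (simp only: hinner_def hconj_mult_self of_real_def scaleR_sum_left)
qed

definition tight_frame :: "nat \<Rightarrow> (nat \<Rightarrow> 'k::hermitian_scalar ^ 'n) \<Rightarrow> real \<Rightarrow> bool" where
  "tight_frame N v A \<longleftrightarrow> (\<forall>x. (\<Sum>i=1..N. (norm (hinner x (v i)))\<^sup>2) = A * (norm x)\<^sup>2)"


section \<open>Jacobi polynomials\<close>

text \<open>The lemmas \<open>degree_jacobi_poly\<close> and \<open>jacobi_poly_orthogonal\<close> below characterise this
  polynomial up to a constant factor, and \<open>poly_jacobi_poly_1\<close> is the usual normalisation.\<close>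

definition jacobi_poly :: "real \<Rightarrow> real \<Rightarrow> nat \<Rightarrow> real poly" where
  "jacobi_poly \<alpha> \<beta> k =
    (\<Sum>s\<le>k. smult (((real k + \<alpha>) gchoose (k - s)) * ((real k + \<beta>) gchoose s))
       ([:-1/2, 1/2:] ^ s * [:1/2, 1/2:] ^ (k - s)))"

lemma poly_jacobi_poly:
  "poly (jacobi_poly \<alpha> \<beta> k) x =
    (\<Sum>s\<le>k. ((real k + \<alpha>) gchoose (k - s)) * ((real k + \<beta>) gchoose s) *
       ((x - 1) / 2) ^ s * ((x + 1) / 2) ^ (k - s))"
proof -
  have "poly [:-1/2, 1/2:] x = (x - 1) / 2" "poly [:1/2, 1/2:] x = (x + 1) / 2"
    by (simp_all add: field_simps)
  then show ?thesis
    by (simp only: jacobi_poly_def poly_sum poly_smult poly_mult poly_power mult.assoc)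
qed

lemma poly_jacobi_poly_1: "poly (jacobi_poly \<alpha> \<beta> k) 1 = (real k + \<alpha>) gchoose k"
proof -
  have "poly (jacobi_poly \<alpha> \<beta> k) 1
      = (\<Sum>s\<le>k. if s = 0 then (real k + \<alpha>) gchoose k else 0)"
    unfolding poly_jacobi_poly by (intro sum.cong) auto
  then show ?thesis by simp
qed

lemma degree_jacobi_poly:
  assumes "\<alpha> > -1" "\<beta> > -1"
  shows "degree (jacobi_poly \<alpha> \<beta> k) = k"
proof -
  let ?T = "\<lambda>s. [:-1/2, 1/2::real:] ^ s * [:1/2, 1/2:] ^ (k - s)"
  have deg: "degree (?T s) = k" if "s \<le> k" for s
    using that by (subst degree_mult_eq) (auto simp: degree_power_eq)
  have lc: "coeff (?T s) k = (1/2) ^ k" if "s \<le> k" for s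
  proof -
    have "coeff (?T s) k = lead_coeff (?T s)"
      using deg[OF that] by simp
    also have "\<dots> = (1/2) ^ s * (1/2) ^ (k - s)"
      by (simp add: lead_coeff_mult lead_coeff_power)
    finally show ?thesis
      using that by (simp flip: power_add)
  qed
  have le: "degree (jacobi_poly \<alpha> \<beta> k) \<le> k"
    unfolding jacobi_poly_def
  proof (rule degree_sum_le)
    fix s assume "s \<in> {..k}"
    then have "degree (?T s) = k"
      using deg by blast
    then show "degree (smult (((real k + \<alpha>) gchoose (k - s)) * ((real k + \<beta>) gchoose s)) (?T s)) \<le> k"
      by (metis degree_smult_le)
  qed simp
  have "coeff (jacobi_poly \<alpha> \<beta> k) k =
      (\<Sum>s\<le>k. ((real k + \<alpha>) gchoose (k - s)) * ((real k + \<beta>) gchoose s) * (1/2) ^ k)"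
    unfolding jacobi_poly_def coeff_sum coeff_smult by (intro sum.cong refl) (simp only: lc atMost_iff)
  also have "\<dots> = (((real k + \<beta>) + (real k + \<alpha>)) gchoose k) * (1/2) ^ k"
    unfolding gbinomial_Vandermonde[of "real k + \<beta>" "real k + \<alpha>" k, symmetric]
      sum_distrib_right atMost_atLeast0
    by (intro sum.cong refl) (simp only: mult_ac)
  also have "\<dots> \<noteq> 0"
    using assms by (auto simp: gbinomial_prod_rev)
  finally show ?thesis
    using le le_degree order_antisym by metis
qed

lemma alternating_sum_pochhammer:
  fixes c :: real
  assumes "m < k"
  shows "(\<Sum>s\<le>k. (-1) ^ s * real (k choose s) * pochhammer (c - real s) m) = 0"
  using assms
proof (induction k arbitrary: m)
  case (Suc k)
  let ?f = "\<lambda>s. pochhammer (c - real s) m"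
  have "(\<Sum>s\<le>Suc k. (-1) ^ s * real (Suc k choose s) * ?f s) =
      ?f 0 + (\<Sum>s\<le>k. (-1) ^ Suc s * real (Suc k choose Suc s) * ?f (Suc s))"
    by (subst sum.atMost_Suc_shift) simp
  also have "(\<Sum>s\<le>k. (-1) ^ Suc s * real (Suc k choose Suc s) * ?f (Suc s)) =
      (\<Sum>s\<le>k. (-1) ^ Suc s * real (k choose s) * ?f (Suc s)) +
      (\<Sum>s\<le>k. (-1) ^ Suc s * real (k choose Suc s) * ?f (Suc s))"
    by (simp add: sum.distrib[symmetric] algebra_simps)
  also have "?f 0 + \<dots> = (\<Sum>s\<le>k. (-1) ^ Suc s * real (k choose s) * ?f (Suc s)) +
      (\<Sum>s\<le>Suc k. (-1) ^ s * real (k choose s) * ?f s)"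
  proof -
    have "(\<Sum>s\<le>Suc k. (-1) ^ s * real (k choose s) * ?f s) =
        ?f 0 + (\<Sum>s\<le>k. (-1) ^ Suc s * real (k choose Suc s) * ?f (Suc s))"
      by (subst sum.atMost_Suc_shift) simp
    then show ?thesis
      by (simp only: add_ac)
  qed
  also have "\<dots> = (\<Sum>s\<le>k. (-1) ^ s * real (k choose s) * (?f s - ?f (Suc s)))"
    by (simp add: sum.distrib[symmetric] algebra_simps)
  also have "\<dots> = 0"
  proof (cases m)
    case (Suc m')
    have "?f s - ?f (Suc s) = real m * pochhammer (c - real s) m'" for s
    proof -
      have "?f s = pochhammer (c - real s) m' * (c - real s + real m')"
        by (simp add: Suc pochhammer_Suc)
      moreover have "?f (Suc s) = (c - real s - 1) * pochhammer (c - real s) m'"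
        by (simp add: Suc pochhammer_rec algebra_simps)
      ultimately show ?thesis
        by (simp add: Suc algebra_simps)
    qed
    then have "(\<Sum>s\<le>k. (-1) ^ s * real (k choose s) * (?f s - ?f (Suc s))) =
        real m * (\<Sum>s\<le>k. (-1) ^ s * real (k choose s) * pochhammer (c - real s) m')"
      by (simp add: sum_distrib_left algebra_simps)
    then show ?thesis
      using Suc.IH[of m'] Suc.prems Suc by simp
  qed simp
  finally show ?case .
qed simp

lemma powr_mult_power:
  fixes u b :: real
  assumes "u \<ge> 0"
  shows "u powr b * u ^ n = u powr (b + real n)"
  using assms by (cases "u = 0") (auto simp: powr_add powr_realpow)

lemma jacobi_poly_monomial_integral:
  assumes ab: "\<alpha> > -1" "\<beta> > -1" and m: "m < k"
  shows "((\<lambda>u. (1 - u) powr \<alpha> * u powr \<beta> * poly (jacobi_poly \<alpha> \<beta> k) (2 * u - 1) * u ^ m)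
    has_integral 0) {0..1}"
proof -
  define C where "C s = ((real k + \<alpha>) gchoose (k - s)) * ((real k + \<beta>) gchoose s)" for s
  define B where "B s = Beta (\<beta> + real (k - s + m) + 1) (\<alpha> + real s + 1)" for s
  let ?f = "\<lambda>s u. u powr (\<beta> + real (k - s + m)) * (1 - u) powr (\<alpha> + real s)"
  have F: "(?f s has_integral B s) {0..1}" for s
    using has_integral_Beta_real[of "\<beta> + real (k - s + m) + 1" "\<alpha> + real s + 1"] ab
    by (simp add: B_def add.assoc)
  have I: "((\<lambda>u. \<Sum>s\<le>k. C s * (-1) ^ s * ?f s u) has_integral (\<Sum>s\<le>k. C s * (-1) ^ s * B s)) {0..1}"
    by (intro has_integral_sum has_integral_mult_right finite_atMost F)
  define G where
    "G = Gamma (real k + \<alpha> + 1) * Gamma (real k + \<beta> + 1) / Gamma (\<alpha> + \<beta> + real (k + m) + 2)"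
  have CB: "C s * B s = G / fact k * (real (k choose s) * pochhammer (\<beta> + real k + 1 - real s) m)"
    if s: "s \<le> k" for s
  proof -
    have np: "x > 0 \<Longrightarrow> x \<notin> \<int>\<^sub>\<le>\<^sub>0" for x :: real
      by (auto elim!: nonpos_Ints_cases)
    have 1: "(real k + \<alpha>) gchoose (k - s) = Gamma (real k + \<alpha> + 1) / (fact (k - s) * Gamma (\<alpha> + real s + 1))"
      using s ab by (subst gbinomial_Gamma) (auto intro!: np simp: of_nat_diff algebra_simps)
    have 2: "(real k + \<beta>) gchoose s = Gamma (real k + \<beta> + 1) / (fact s * Gamma (\<beta> + real k + 1 - real s))"
      using s ab by (subst gbinomial_Gamma) (auto intro!: np simp: of_nat_diff algebra_simps)
    have 3: "pochhammer (\<beta> + real k + 1 - real s) m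
        = Gamma (\<beta> + real (k - s + m) + 1) / Gamma (\<beta> + real k + 1 - real s)"
      using s ab by (subst pochhammer_Gamma) (auto intro!: np simp: of_nat_diff algebra_simps)
    have 4: "B s = Gamma (\<beta> + real (k - s + m) + 1) * Gamma (\<alpha> + real s + 1)
        / Gamma (\<alpha> + \<beta> + real (k + m) + 2)"
      using s by (simp add: B_def Beta_def of_nat_diff algebra_simps)
    have aux: "(a / (f * g)) * (b / (f' * h)) * (p * g / c) = (a * b / c) / e * (e / (f' * f) * (p / h))"
      if "g \<noteq> 0" "e \<noteq> 0" for a b c e f f' g h p :: real
      using that by (simp add: field_simps)
    have "Gamma (\<alpha> + real s + 1) \<noteq> 0"
      using ab by (intro less_imp_neq[symmetric] Gamma_real_pos) simp
    then show ?thesis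
      unfolding C_def 1 2 3 4 G_def binomial_fact[OF s] by (rule aux) simp
  qed
  have "(\<Sum>s\<le>k. C s * (-1) ^ s * B s) =
      (\<Sum>s\<le>k. G / fact k * ((-1) ^ s * real (k choose s) * pochhammer (\<beta> + real k + 1 - real s) m))"
  proof (intro sum.cong refl)
    fix s assume "s \<in> {..k}"
    then have "C s * B s * (-1) ^ s = G / fact k * (real (k choose s) * pochhammer (\<beta> + real k + 1 - real s) m) * (-1) ^ s"
      using CB by simp
    then show "C s * (-1) ^ s * B s =
        G / fact k * ((-1) ^ s * real (k choose s) * pochhammer (\<beta> + real k + 1 - real s) m)"
      by (simp only: mult_ac)
  qed
  also have "\<dots> = 0"
    unfolding sum_distrib_left[symmetric] using alternating_sum_pochhammer[OF m] by simp
  finally have Z: "(\<Sum>s\<le>k. C s * (-1) ^ s * B s) = 0" .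
  have E: "(\<Sum>s\<le>k. C s * (-1) ^ s * ?f s u) =
      (1 - u) powr \<alpha> * u powr \<beta> * poly (jacobi_poly \<alpha> \<beta> k) (2 * u - 1) * u ^ m"
    if u: "u \<in> {0..1}" for u
  proof -
    have "C s * (-1) ^ s * ?f s u = (1 - u) powr \<alpha> * u powr \<beta> * (C s * (u - 1) ^ s * u ^ (k - s)) * u ^ m" for s
    proof -
      have "?f s u = (u powr \<beta> * u ^ (k - s + m)) * ((1 - u) powr \<alpha> * (1 - u) ^ s)"
        using u by (simp add: powr_mult_power)
      moreover have "(u - 1) ^ s = (-1) ^ s * (1 - u) ^ s"
        by (simp flip: power_mult_distrib)
      ultimately show ?thesis
        by (simp add: power_add)
    qed
    moreover have "poly (jacobi_poly \<alpha> \<beta> k) (2 * u - 1) = (\<Sum>s\<le>k. C s * (u - 1) ^ s * u ^ (k - s))"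
      unfolding poly_jacobi_poly C_def by (intro sum.cong refl) (simp add: diff_divide_distrib)
    ultimately show ?thesis
      by (simp only: sum_distrib_left sum_distrib_right)
  qed
  show ?thesis
    using I unfolding Z by (rule has_integral_eq[rotated]) (use E in auto)
qed

theorem jacobi_poly_orthogonal:
  assumes ab: "\<alpha> > -1" "\<beta> > -1" and r: "degree r < k"
  shows "((\<lambda>x. (1 - x) powr \<alpha> * (1 + x) powr \<beta> * poly (jacobi_poly \<alpha> \<beta> k) x * poly r x)
    has_integral 0) {-1..1}"
proof -
  define q where "q = pcompose r [:-1, 2:]"
  have q: "degree q < k" "poly r (2 * u - 1) = (\<Sum>m\<le>degree q. coeff q m * u ^ m)" for u
  proof -
    show "degree q < k"
      using r by (simp add: q_def degree_pcompose)
    have "poly r (2 * u - 1) = poly q u"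
      by (simp add: q_def poly_pcompose algebra_simps)
    then show "poly r (2 * u - 1) = (\<Sum>m\<le>degree q. coeff q m * u ^ m)"
      by (simp add: poly_altdef)
  qed
  let ?w = "\<lambda>u. (1 - u) powr \<alpha> * u powr \<beta> * poly (jacobi_poly \<alpha> \<beta> k) (2 * u - 1)"
  have E: "?w u * poly r (2 * u - 1) = (\<Sum>m\<le>degree q. coeff q m * (?w u * u ^ m))" for u
    unfolding q(2) sum_distrib_left by (intro sum.cong refl) (simp only: mult_ac)
  have "((\<lambda>u. \<Sum>m\<le>degree q. coeff q m * (?w u * u ^ m)) has_integral (\<Sum>m\<le>degree q. coeff q m * 0)) {0..1}"
    using q(1) by (intro has_integral_sum has_integral_mult_right jacobi_poly_monomial_integral ab) auto
  then have "((\<lambda>u. ?w u * poly r (2 * u - 1)) has_integral 0) {0..1}"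
    by (simp only: E mult_zero_right sum.neutral_const)
  then have "((\<lambda>u. 2 powr \<alpha> * 2 powr \<beta> * (?w u * poly r (2 * u - 1))) has_integral 0) (cbox 0 1)"
    using has_integral_mult_right[of _ 0 "{0..1}" "2 powr \<alpha> * 2 powr \<beta>"] by simp
  from has_integral_affinity[OF this, of "1/2" "1/2"]
  have "((\<lambda>x. 2 powr \<alpha> * 2 powr \<beta> * (?w (x/2 + 1/2) * poly r (2 * (x/2 + 1/2) - 1))) has_integral 0)
      ((\<lambda>x. 2 * x - 1) ` {0..1})"
    by simp
  moreover have "(\<lambda>x::real. 2 * x - 1) ` {0..1} = {-1..1}"
    using image_affinity_atLeastAtMost[of 2 "-1" 0 "1::real"] by simp
  ultimately have I: "((\<lambda>x. 2 powr \<alpha> * 2 powr \<beta> *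
      (?w (x/2 + 1/2) * poly r (2 * (x/2 + 1/2) - 1))) has_integral 0) {-1..1}"
    by (simp only:)
  have "2 powr \<alpha> * 2 powr \<beta> * (?w (x/2 + 1/2) * poly r (2 * (x/2 + 1/2) - 1)) =
      (1 - x) powr \<alpha> * (1 + x) powr \<beta> * poly (jacobi_poly \<alpha> \<beta> k) x * poly r x"
    if "x \<in> {-1..1}" for x
  proof -
    have "(1 - x) powr \<alpha> = (2 * (1 - (x/2 + 1/2))) powr \<alpha>"
      "(1 + x) powr \<beta> = (2 * (x/2 + 1/2)) powr \<beta>"
      by (simp_all add: add.commute)
    moreover have "(2 * (1 - (x/2 + 1/2))) powr \<alpha> = 2 powr \<alpha> * (1 - (x/2 + 1/2)) powr \<alpha>"
      "(2 * (x/2 + 1/2)) powr \<beta> = 2 powr \<beta> * (x/2 + 1/2) powr \<beta>"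
      using that by (intro powr_mult; simp)+
    moreover have "2 * (x/2 + 1/2) - 1 = x" by simp
    ultimately show ?thesis by (simp only: mult_ac)
  qed
  then show ?thesis
    by (rule has_integral_eq[OF _ I])
qed


section \<open>Zonal functions of projective space\<close>

text \<open>Here \<open>m\<close> is the real dimension of the scalars, and \<open>t\<close> stands for \<open>norm (hinner x y)\<close>
  of unit vectors \<open>x\<close>, \<open>y\<close>.\<close>

definition zonal :: "nat \<Rightarrow> nat \<Rightarrow> nat \<Rightarrow> real \<Rightarrow> real" where
  "zonal m d k t =
    (let P = jacobi_poly ((real d - 1) * (real m / 2) - 1) (real m / 2 - 1) k
     in poly P (2 * t\<^sup>2 - 1) / poly P 1)"

text \<open>The sum over \<open>k \<ge> 2\<close> is indexed from \<open>0\<close>.\<close>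

definition majorant :: "nat \<Rightarrow> nat \<Rightarrow> (nat \<Rightarrow> real) \<Rightarrow> real \<Rightarrow> real" where
  "majorant m d a t = a 0 + a 1 * t\<^sup>2 + (\<Sum>k. a (k + 2) * zonal m d (k + 2) t)"

definition powr_majorized :: "nat \<Rightarrow> nat \<Rightarrow> real \<Rightarrow> (nat \<Rightarrow> real) \<Rightarrow> bool" where
  "powr_majorized m d q a \<longleftrightarrow>
    (\<forall>t\<in>{0..1}. summable (\<lambda>k. a (k + 2) * zonal m d (k + 2) t) \<and> t powr q \<le> majorant m d a t)"

end

theory Submission
  imports Defs
begin

text \<open>
  Write \<open>y\<^sub>i = r\<^sub>i e\<^sub>i\<close> with unit vectors \<open>e\<^sub>i\<close>, and let \<open>t\<^sub>i\<^sub>j = |\<langle>e\<^sub>i, e\<^sub>j\<rangle>|\<close>. Bounding each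
  \<open>t\<^sub>i\<^sub>j\<^sup>q\<close> by \<open>h(t\<^sub>i\<^sub>j)\<close> with the weights \<open>w\<^sub>i = r\<^sub>i\<^sup>q\<close>, the terms with \<open>k \<ge> 2\<close> contribute nothing positive
  because the zonal kernels are positive definite. The frame condition gives
  \<open>\<Sum> r\<^sub>i\<^sup>2 = N\<close>, so that \<open>\<Sum> w\<^sub>i \<le> N \<le> \<Sum> w\<^sub>i\<^sup>2\<close> by Bernoulli's inequality, and with the arithmetic-geometric
  mean inequality
  \<open>w\<^sub>i w\<^sub>j \<le> (r\<^sub>i\<^bsup>2q-2\<^esup> r\<^sub>j\<^sup>2 + r\<^sub>j\<^bsup>2q-2\<^esup> r\<^sub>i\<^sup>2) / 2\<close> it also bounds \<open>\<Sum> w\<^sub>i w\<^sub>j t\<^sub>i\<^sub>j\<^sup>2\<close> by \<open>N\<^sup>2 / d\<close>.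

  Positive definiteness uses no integration: the kernel \<open>|\<langle>x, y\<rangle>|\<^bsup>2k\<^esup>\<close> is a finite sum of products
  \<open>f(x) f(y)\<close> of polynomials, and its harmonic projection in \<open>y\<close>, a combination of powers of the
  Laplacian, is the zonal kernel. The recurrence of the Jacobi coefficients says that the
  latter is harmonic in \<open>x\<close>.
\<close>

unbundle no Formal_Power_Series.fps_syntax

section \<open>The Laplacian of polynomial functions\<close>

definition dir_deriv :: "'a::euclidean_space \<Rightarrow> ('a \<Rightarrow> real) \<Rightarrow> 'a \<Rightarrow> real" where
  "dir_deriv e f x = deriv (\<lambda>t. f (x + t *\<^sub>R e)) 0"

text \<open>The conclusion is an equation of functions, so that it can be rewritten beneath a second
  \<open>dir_deriv\<close>.\<close>

lemma dir_deriv_eqI: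
  "(\<And>x. ((\<lambda>t. f (x + t *\<^sub>R e)) has_real_derivative g x) (at 0)) \<Longrightarrow> dir_deriv e f = g"
  by (auto simp: dir_deriv_def fun_eq_iff intro!: DERIV_imp_deriv)

lemma has_dir_deriv:
  assumes "real_polynomial_function f"
  shows "((\<lambda>t. f (x + t *\<^sub>R e)) has_real_derivative dir_deriv e f x) (at 0)"
proof -
  have "(\<lambda>t. f (x + t *\<^sub>R e)) differentiable (at 0)"
    using assms
  proof induction
    case (linear f)
    interpret bounded_linear f by (rule linear)
    show ?case by (simp add: add scaleR)
  qed simp_all
  then show ?thesis
    by (simp add: dir_deriv_def DERIV_deriv_iff_real_differentiable)
qed

lemma dir_deriv_linear:
  assumes "bounded_linear f"
  shows "dir_deriv e f = (\<lambda>_. f e)"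
proof -
  interpret bounded_linear f by (rule assms)
  show ?thesis
    by (rule dir_deriv_eqI) (auto simp: add scaleR intro!: derivative_eq_intros)
qed

lemma dir_deriv_const [simp]: "dir_deriv e (\<lambda>_. c) = (\<lambda>_. 0)"
  by (rule dir_deriv_eqI) simp

lemma dir_deriv_add:
  assumes "real_polynomial_function f" "real_polynomial_function g"
  shows "dir_deriv e (\<lambda>x. f x + g x) = (\<lambda>x. dir_deriv e f x + dir_deriv e g x)"
  using assms by (intro dir_deriv_eqI DERIV_add has_dir_deriv)

lemma dir_deriv_mult:
  assumes "real_polynomial_function f" "real_polynomial_function g"
  shows "dir_deriv e (\<lambda>x. f x * g x) = (\<lambda>x. dir_deriv e f x * g x + f x * dir_deriv e g x)"
proof (rule dir_deriv_eqI)
  fix x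
  show "((\<lambda>t. f (x + t *\<^sub>R e) * g (x + t *\<^sub>R e)) has_real_derivative
      dir_deriv e f x * g x + f x * dir_deriv e g x) (at 0)"
    using DERIV_mult[OF has_dir_deriv[OF assms(1), of x e] has_dir_deriv[OF assms(2), of x e]]
    by (simp add: mult.commute)
qed

lemma real_polynomial_function_dir_deriv [intro]:
  "real_polynomial_function f \<Longrightarrow> real_polynomial_function (dir_deriv e f)"
  by (induction rule: real_polynomial_function.induct)
    (auto simp: dir_deriv_linear dir_deriv_add dir_deriv_mult)

section \<open>Laplacian and gradient product: Leibniz and power rules\<close>

definition laplacian :: "('a::euclidean_space \<Rightarrow> real) \<Rightarrow> 'a \<Rightarrow> real" where
  "laplacian f x = (\<Sum>e\<in>Basis. dir_deriv e (dir_deriv e f) x)"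

definition grad_inner :: "('a::euclidean_space \<Rightarrow> real) \<Rightarrow> ('a \<Rightarrow> real) \<Rightarrow> 'a \<Rightarrow> real" where
  "grad_inner f g x = (\<Sum>e\<in>Basis. dir_deriv e f x * dir_deriv e g x)"

lemma real_polynomial_function_laplacian [intro]:
  "real_polynomial_function f \<Longrightarrow> real_polynomial_function (laplacian f)"
  unfolding laplacian_def[abs_def] by (intro real_polynomial_function_sum) auto

lemma real_polynomial_function_funpow_laplacian [intro]:
  "real_polynomial_function f \<Longrightarrow> real_polynomial_function ((laplacian ^^ j) f)"
  by (induction j) auto

lemma laplacian_const [simp]: "laplacian (\<lambda>_. c) = (\<lambda>_. 0)"
  by (simp add: laplacian_def fun_eq_iff)

lemma laplacian_add:
  assumes "real_polynomial_function f" "real_polynomial_function g"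
  shows "laplacian (\<lambda>x. f x + g x) = (\<lambda>x. laplacian f x + laplacian g x)"
  using assms by (simp add: laplacian_def fun_eq_iff dir_deriv_add sum.distrib
    real_polynomial_function_dir_deriv)

lemma laplacian_mult:
  assumes "real_polynomial_function f" "real_polynomial_function g"
  shows "laplacian (\<lambda>x. f x * g x) =
    (\<lambda>x. laplacian f x * g x + f x * laplacian g x + 2 * grad_inner f g x)"
  using assms by (simp add: laplacian_def grad_inner_def fun_eq_iff dir_deriv_add dir_deriv_mult
    real_polynomial_function_dir_deriv real_polynomial_function.intros sum.distrib algebra_simps
    sum_distrib_left)

lemma laplacian_cmult:
  "real_polynomial_function f \<Longrightarrow> laplacian (\<lambda>x. c * f x) = (\<lambda>x. c * laplacian f x)"
  by (simp add: laplacian_mult real_polynomial_function.intros grad_inner_def)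

lemma laplacian_sum:
  assumes "\<And>i. i \<in> I \<Longrightarrow> real_polynomial_function (f i)"
  shows "laplacian (\<lambda>x. \<Sum>i\<in>I. f i x) = (\<lambda>x. \<Sum>i\<in>I. laplacian (f i) x)"
  using assms
proof (induction I rule: infinite_finite_induct)
  case (insert i I)
  have "real_polynomial_function (\<lambda>x. \<Sum>i\<in>I. f i x)"
    using insert by (intro real_polynomial_function_sum) auto
  with insert show ?case
    by (simp add: laplacian_add)
qed simp_all

lemma grad_inner_commute: "grad_inner f g = grad_inner g f"
  by (simp add: grad_inner_def fun_eq_iff mult.commute)

lemma grad_inner_mult_left:
  assumes "real_polynomial_function f" "real_polynomial_function g"
  shows "grad_inner (\<lambda>x. f x * g x) h = (\<lambda>x. g x * grad_inner f h x + f x * grad_inner g h x)"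
  using assms by (simp add: grad_inner_def fun_eq_iff dir_deriv_mult sum.distrib algebra_simps
    sum_distrib_left)

lemma grad_inner_power_left:
  assumes "real_polynomial_function f"
  shows "grad_inner (\<lambda>x. f x ^ n) g = (\<lambda>x. real n * f x ^ (n - 1) * grad_inner f g x)"
proof (induction n)
  case 0
  show ?case by (simp add: grad_inner_def)
next
  case (Suc n)
  have "grad_inner (\<lambda>x. f x ^ Suc n) g = (\<lambda>x. f x ^ n * grad_inner f g x + f x * grad_inner (\<lambda>x. f x ^ n) g x)"
    using assms by (simp add: grad_inner_mult_left real_polynomial_function_power)
  then show ?case
    unfolding Suc by (cases n) (auto simp: fun_eq_iff algebra_simps)
qed

text \<open>Induction with the Leibniz rule. The truncated exponents are harmless: both coefficients
  vanish at \<open>n = 0\<close>, and the second one also at \<open>n = 1\<close>.\<close>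

lemma laplacian_power:
  assumes "real_polynomial_function f"
  shows "laplacian (\<lambda>x. f x ^ n) =
    (\<lambda>x. real n * f x ^ (n - 1) * laplacian f x
      + real n * (real n - 1) * f x ^ (n - 2) * grad_inner f f x)"
proof (induction n)
  case (Suc n)
  have "laplacian (\<lambda>x. f x ^ Suc n) = (\<lambda>x. laplacian f x * f x ^ n + f x * laplacian (\<lambda>x. f x ^ n) x
      + 2 * grad_inner (\<lambda>x. f x ^ n) f x)"
    using assms by (simp add: laplacian_mult real_polynomial_function_power
      grad_inner_commute[of f "\<lambda>x. f x ^ n"])
  also have "\<dots> = (\<lambda>x. real (Suc n) * f x ^ (Suc n - 1) * laplacian f x
      + real (Suc n) * (real (Suc n) - 1) * f x ^ (Suc n - 2) * grad_inner f f x)"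
  proof (cases "n \<le> 1")
    case True
    then have "n = 0 \<or> n = 1" by auto
    then show ?thesis
      unfolding Suc grad_inner_power_left[OF assms] by (auto simp: algebra_simps)
  next
    case False
    then obtain m where "n = Suc (Suc m)" by (metis One_nat_def not_less_eq_eq not0_implies_Suc le0)
    then show ?thesis
      unfolding Suc grad_inner_power_left[OF assms] by (simp add: fun_eq_iff algebra_simps)
  qed
  finally show ?case .
qed simp

section \<open>The Hermitian product\<close>

text \<open>The axiom of \<open>hermitian_scalar\<close> leaves \<open>hconj 0\<close> unspecified.\<close>

class hermitian_euclidean = hermitian_scalar + euclidean_space +
  assumes hconj_zero [simp]: "hconj 0 = 0"

instance real :: hermitian_euclidean
  by standard (simp add: hconj_real_def)

instance complex :: hermitian_euclidean
  by standard (simp add: hconj_complex_def)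

instance quat :: hermitian_euclidean
  by standard (simp add: hconj_quat_def zero_quat_def)

text \<open>Multiplying \<open>hconj_mult_self\<close> by \<open>inverse x\<close> from the right
  determines the conjugation. The adjoint rules rest on this formula, for all three scalars at
  once.\<close>

lemma hconj_eq:
  fixes x :: "'k::hermitian_euclidean"
  shows "hconj x = ((norm x)\<^sup>2) *\<^sub>R inverse x"
proof (cases "x = 0")
  case False
  then have "hconj x = (hconj x * x) * inverse x"
    by (simp add: mult.assoc)
  then show ?thesis
    by (simp add: hconj_mult_self)
qed simp

lemma hconj_one [simp]: "hconj (1::'k::hermitian_euclidean) = 1"
  by (simp add: hconj_eq)

lemma norm_hconj [simp]: "norm (hconj (x::'k::hermitian_euclidean)) = norm x"
  by (cases "x = 0") (simp_all add: hconj_eq norm_inverse power2_eq_square)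

lemma hconj_scaleR: "hconj (a *\<^sub>R (x::'k::hermitian_euclidean)) = a *\<^sub>R hconj x"
  by (cases "a = 0") (simp_all add: hconj_eq power_mult_distrib power2_eq_square[of a] inverse_scaleR_distrib)

text \<open>Multiplicativity of the norm says that multiplication by a fixed scalar is a similarity;
  polarization gives the two adjoint rules below.\<close>

lemma inner_mult_mult_left:
  fixes a :: "'k::{real_normed_div_algebra, real_inner}"
  shows "(a * x) \<bullet> (a * y) = (norm a)\<^sup>2 * (x \<bullet> y)"
  by (simp add: dot_norm norm_mult power_mult_distrib right_diff_distrib flip: distrib_left)

lemma inner_mult_mult_right:
  fixes a :: "'k::{real_normed_div_algebra, real_inner}"
  shows "(x * a) \<bullet> (y * a) = (norm a)\<^sup>2 * (x \<bullet> y)"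
  by (simp add: dot_norm norm_mult power_mult_distrib right_diff_distrib flip: distrib_right)

lemma inner_hconj_mult:
  fixes x :: "'k::hermitian_euclidean"
  shows "c \<bullet> (hconj x * y) = (x * c) \<bullet> y"
proof (cases "x = 0")
  case False
  then have "(x * c) \<bullet> y = (x * c) \<bullet> (x * (inverse x * y))"
    by (simp add: mult.assoc[symmetric])
  then show ?thesis
    by (simp add: inner_mult_mult_left hconj_eq)
qed simp

lemma inner_mult_hconj:
  fixes c :: "'k::hermitian_euclidean"
  shows "x \<bullet> (y * hconj c) = (x * c) \<bullet> y"
proof (cases "c = 0")
  case False
  then have "(x * c) \<bullet> y = (x * c) \<bullet> ((y * inverse c) * c)"
    by (simp add: mult.assoc)
  then show ?thesis
    by (simp add: inner_mult_mult_right hconj_eq)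
qed simp

lemma norm_hinner_le:
  fixes x y :: "'k::hermitian_euclidean ^ 'n"
  shows "norm (hinner x y) \<le> norm x * norm y"
proof -
  have "norm (hinner x y) \<le> (\<Sum>i\<in>UNIV. \<bar>norm (x $ i)\<bar> * \<bar>norm (y $ i)\<bar>)"
    unfolding hinner_def by (rule order.trans[OF norm_sum]) (simp add: norm_mult)
  also have "\<dots> \<le> norm x * norm y"
    unfolding norm_vec_def by (rule L2_set_mult_ineq)
  finally show ?thesis .
qed

lemma hinner_scaleR_left:
  "hinner (a *\<^sub>R (x :: 'k::hermitian_euclidean ^ 'n)) y = a *\<^sub>R hinner x y"
  by (simp add: hinner_def hconj_scaleR scaleR_sum_right)

lemma hinner_scaleR_right:
  "hinner (x :: 'k::hermitian_euclidean ^ 'n) (a *\<^sub>R y) = a *\<^sub>R hinner x y"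
  by (simp add: hinner_def scaleR_sum_right)

lemma hinner_axis: "hinner (axis k (1::'k::hermitian_euclidean)) v = v $ k"
proof -
  have "hinner (axis k (1::'k)) v = (\<Sum>i\<in>UNIV. if i = k then v $ i else 0)"
    unfolding hinner_def by (intro sum.cong) (auto simp: axis_def)
  then show ?thesis by simp
qed

text \<open>This vector represents the real functional taking \<open>x\<close> to the
  \<open>c\<close>-component of \<open>hinner x y\<close>. For nonzero \<open>y\<close> and
  \<open>c\<close> in \<open>Basis\<close> such vectors form an orthogonal real basis of the right
  line spanned by \<open>y\<close>.\<close>

definition hconj_shift :: "'k::hermitian_euclidean ^ 'n \<Rightarrow> 'k \<Rightarrow> 'k ^ 'n" where
  "hconj_shift y c = (\<chi> i. y $ i * hconj c)"

lemma inner_hinner: "hinner x y \<bullet> c = x \<bullet> hconj_shift y c"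
  for x :: "'k::hermitian_euclidean ^ 'n"
  by (simp add: inner_commute[of _ c] hinner_def hconj_shift_def inner_vec_def inner_sum_right
    inner_hconj_mult inner_mult_hconj)

lemma inner_hconj_shift:
  fixes y :: "'k::hermitian_euclidean ^ 'n"
  assumes "c \<in> Basis" "c' \<in> Basis"
  shows "hconj_shift y c \<bullet> hconj_shift y c' = (if c = c' then (norm y)\<^sup>2 else 0)"
proof -
  \<comment> \<open>Left multiplication by \<open>b\<close> is a similarity, and conjugation
    preserves the inner product: the adjoint rules carry \<open>hconj c \<bullet> hconj c'\<close>
    to \<open>c' \<bullet> c\<close> by way of \<open>hconj c * c'\<close> paired with
    \<open>1\<close>.\<close>
  have *: "(b * hconj c) \<bullet> (b * hconj c') = (norm b)\<^sup>2 * (c' \<bullet> c)" for b :: 'k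
    using inner_mult_hconj[of "hconj c" 1 c'] inner_hconj_mult[of 1 c c']
    by (simp add: inner_mult_mult_left inner_commute)
  have "hconj_shift y c \<bullet> hconj_shift y c' = (norm y)\<^sup>2 * (c' \<bullet> c)"
    by (simp add: hconj_shift_def inner_vec_def * power2_norm_eq_inner flip: sum_distrib_right)
  then show ?thesis
    using assms by (auto simp: inner_Basis)
qed

lemma norm_hinner_sq_eq_sum:
  fixes x y :: "'k::hermitian_euclidean ^ 'n"
  shows "(norm (hinner x y))\<^sup>2 = (\<Sum>c\<in>Basis. (x \<bullet> hconj_shift y c)\<^sup>2)"
proof -
  have "(norm (hinner x y))\<^sup>2 = (\<Sum>c\<in>Basis. (hinner x y \<bullet> c) * (hinner x y \<bullet> c))"
    unfolding power2_norm_eq_inner by (rule euclidean_inner)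
  then show ?thesis
    by (simp only: inner_hinner power2_eq_square)
qed

text \<open>The entries of the rank one matrix \<open>x x\<^sup>*\<close> give the reproducing features of
  \<open>|\<langle>x, y\<rangle>|\<^sup>2\<close>.\<close>

lemma norm_hinner_sq_features:
  fixes x y :: "'k::hermitian_euclidean ^ 'n"
  shows "(norm (hinner x y))\<^sup>2 = (\<Sum>i\<in>UNIV. \<Sum>j\<in>UNIV. \<Sum>c\<in>Basis.
    ((c * x $ i) \<bullet> x $ j) * ((c * y $ i) \<bullet> y $ j))"
proof -
  have *: "(a * hconj b) \<bullet> c = (c * b) \<bullet> a" for a b c :: 'k
    using inner_mult_hconj[of c a b] by (simp only: inner_commute)
  have "(hconj (x $ i) * y $ i) \<bullet> (hconj (x $ j) * y $ j) =
      (\<Sum>c\<in>Basis. ((c * x $ i) \<bullet> x $ j) * ((c * y $ i) \<bullet> y $ j))" for i j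
  proof -
    \<comment> \<open>Both sides reduce to \<open>x $ j * hconj (x $ i) * y $ i\<close> paired with
      \<open>y $ j\<close>. The right-hand form separates \<open>x\<close> from
      \<open>y\<close>.\<close>
    have "(hconj (x $ i) * y $ i) \<bullet> (hconj (x $ j) * y $ j) = (x $ j * hconj (x $ i)) \<bullet> (y $ j * hconj (y $ i))"
      by (simp only: inner_hconj_mult inner_mult_hconj mult.assoc)
    also have "\<dots> = (\<Sum>c\<in>Basis. ((x $ j * hconj (x $ i)) \<bullet> c) * ((y $ j * hconj (y $ i)) \<bullet> c))"
      by (rule euclidean_inner)
    also have "\<dots> = (\<Sum>c\<in>Basis. ((c * x $ i) \<bullet> x $ j) * ((c * y $ i) \<bullet> y $ j))"
      by (simp only: *)
    finally show ?thesis .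
  qed
  then show ?thesis
    by (simp only: power2_norm_eq_inner hinner_def inner_sum_left inner_sum_right)
      (rule sum.swap)
qed

text \<open>The feature expansion pairs the same real functions at \<open>x\<close> and at
  \<open>y\<close>, hence is symmetric.\<close>

lemma norm_hinner_commute:
  fixes x y :: "'k::hermitian_euclidean ^ 'n"
  shows "norm (hinner x y) = norm (hinner y x)"
proof -
  have "(norm (hinner x y))\<^sup>2 = (norm (hinner y x))\<^sup>2"
    unfolding norm_hinner_sq_features by (intro sum.cong refl mult.commute)
  then show ?thesis by simp
qed

text \<open>Testing the frame identity on the coordinate vectors and adding up computes the trace of
  the frame operator.\<close>

lemma sum_norm_sq_tight_frame:
  fixes y :: "nat \<Rightarrow> 'k::hermitian_euclidean ^ 'n"
  assumes "tight_frame N y A"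
  shows "(\<Sum>i=1..N. (norm (y i))\<^sup>2) = A * real CARD('n)"
proof -
  have 1: "norm (axis k (1::'k) :: 'k ^ 'n) = 1" for k
    using norm_one[where 'a='k, unfolded norm_eq_sqrt_inner]
    by (simp add: norm_eq_sqrt_inner inner_axis_axis)
  have "(norm v)\<^sup>2 = (\<Sum>k\<in>UNIV. (norm (hinner (axis k 1) v))\<^sup>2)" for v :: "'k ^ 'n"
    by (simp add: hinner_axis norm_vec_def L2_set_def sum_nonneg)
  then have "(\<Sum>i=1..N. (norm (y i))\<^sup>2) = (\<Sum>k\<in>UNIV. \<Sum>i=1..N. (norm (hinner (axis k 1) (y i)))\<^sup>2)"
    by (subst sum.swap) simp
  also have "\<dots> = (\<Sum>k\<in>(UNIV::'n set). A)"
    using assms by (simp add: tight_frame_def 1)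
  finally show ?thesis by (simp add: mult.commute)
qed

section \<open>Derivatives of the two basic quadratic forms\<close>

lemma real_polynomial_function_norm_hinner_sq [intro]:
  fixes y :: "'k::hermitian_euclidean ^ 'n"
  shows "real_polynomial_function (\<lambda>x. (norm (hinner x y))\<^sup>2)"
  unfolding norm_hinner_sq_eq_sum
  by (intro real_polynomial_function_sum real_polynomial_function_power real_polynomial_function.intros(1)
    bounded_linear_inner_left finite_Basis)

lemma norm_sq_eq_sum: "(norm (x::'a::euclidean_space))\<^sup>2 = (\<Sum>b\<in>Basis. (x \<bullet> b)\<^sup>2)"
  by (simp add: power2_norm_eq_inner euclidean_inner[of x x] flip: power2_eq_square)

lemma real_polynomial_function_norm_sq [intro]:
  "real_polynomial_function (\<lambda>x::'a::euclidean_space. (norm x)\<^sup>2)"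
  unfolding norm_sq_eq_sum
  by (intro real_polynomial_function_sum real_polynomial_function_power real_polynomial_function.intros(1)
    bounded_linear_inner_left finite_Basis)

lemma dir_deriv_norm_sq: "dir_deriv e (\<lambda>x. (norm x)\<^sup>2) = (\<lambda>x. 2 * (x \<bullet> e))"
proof (rule dir_deriv_eqI)
  fix x :: 'a
  have "(norm (x + t *\<^sub>R e))\<^sup>2 = x \<bullet> x + t * (2 * (x \<bullet> e)) + t * t * (e \<bullet> e)" for t
    by (simp add: power2_norm_eq_inner inner_add inner_commute[of e x] algebra_simps)
  then show "((\<lambda>t. (norm (x + t *\<^sub>R e))\<^sup>2) has_real_derivative 2 * (x \<bullet> e)) (at 0)"
    by (auto intro!: derivative_eq_intros)
qed

lemma dir_deriv_inner: "dir_deriv e (\<lambda>x. c * (x \<bullet> z)) = (\<lambda>_. c * (e \<bullet> z))"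
  by (rule dir_deriv_linear) (intro bounded_linear_const_mult bounded_linear_inner_left)

lemma dir_deriv_norm_hinner_sq:
  fixes y :: "'k::hermitian_euclidean ^ 'n"
  shows "dir_deriv e (\<lambda>x. (norm (hinner x y))\<^sup>2) =
    (\<lambda>x. 2 * (e \<bullet> (\<Sum>c\<in>Basis. (x \<bullet> hconj_shift y c) *\<^sub>R hconj_shift y c)))"
proof (rule dir_deriv_eqI)
  fix x :: "'k ^ 'n"
  show "((\<lambda>t. (norm (hinner (x + t *\<^sub>R e) y))\<^sup>2) has_real_derivative
      2 * (e \<bullet> (\<Sum>c\<in>Basis. (x \<bullet> hconj_shift y c) *\<^sub>R hconj_shift y c))) (at 0)"
    unfolding norm_hinner_sq_eq_sum inner_add_left inner_scaleR_left inner_sum_right inner_scaleR_right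
    by (auto intro!: derivative_eq_intros simp: sum_distrib_left algebra_simps)
qed

lemma sum_Basis_inner: "(\<Sum>e\<in>Basis. (e \<bullet> v) * (e \<bullet> w)) = v \<bullet> (w::'a::euclidean_space)"
  by (simp add: euclidean_inner[of v w] inner_commute)

lemma grad_inner_norm_sq:
  "grad_inner (\<lambda>x. (norm x)\<^sup>2) (\<lambda>x. (norm x)\<^sup>2) = (\<lambda>x::'a::euclidean_space. 4 * (norm x)\<^sup>2)"
proof
  fix x :: 'a
  show "grad_inner (\<lambda>x. (norm x)\<^sup>2) (\<lambda>x. (norm x)\<^sup>2) x = 4 * (norm x)\<^sup>2"
    by (simp add: grad_inner_def dir_deriv_norm_sq norm_sq_eq_sum[of x] sum_distrib_left
      power2_eq_square[of "x \<bullet> _"])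
qed

lemma laplacian_norm_sq:
  "laplacian (\<lambda>x. (norm x)\<^sup>2) = (\<lambda>x::'a::euclidean_space. 2 * real DIM('a))"
  by (simp add: laplacian_def dir_deriv_norm_sq dir_deriv_inner fun_eq_iff)

text \<open>The gradient of the squared norm is \<open>2 x\<close>, so this is twice Euler's
  identity for a form of degree 2.\<close>

lemma grad_inner_norm_sq_norm_hinner_sq:
  fixes y :: "'k::hermitian_euclidean ^ 'n"
  shows "grad_inner (\<lambda>x. (norm x)\<^sup>2) (\<lambda>x. (norm (hinner x y))\<^sup>2) = (\<lambda>x. 4 * (norm (hinner x y))\<^sup>2)"
proof
  fix x
  let ?z = "\<Sum>c\<in>Basis. (x \<bullet> hconj_shift y c) *\<^sub>R hconj_shift y c"
  have "grad_inner (\<lambda>x. (norm x)\<^sup>2) (\<lambda>x. (norm (hinner x y))\<^sup>2) x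
      = (\<Sum>e\<in>Basis. 4 * ((e \<bullet> x) * (e \<bullet> ?z)))"
    by (simp add: grad_inner_def dir_deriv_norm_sq dir_deriv_norm_hinner_sq inner_commute mult_ac
      del: inner_sum_right inner_scaleR_right)
  also have "\<dots> = 4 * (x \<bullet> ?z)"
    unfolding sum_distrib_left[symmetric] sum_Basis_inner ..
  also have "\<dots> = 4 * (norm (hinner x y))\<^sup>2"
    by (simp add: norm_hinner_sq_eq_sum inner_sum_right power2_eq_square[of "x \<bullet> _"])
  finally show "grad_inner (\<lambda>x. (norm x)\<^sup>2) (\<lambda>x. (norm (hinner x y))\<^sup>2) x = 4 * (norm (hinner x y))\<^sup>2" .
qed

text \<open>Half the gradient is \<open>?z\<close>, a combination of the vectors
  \<open>hconj_shift y c\<close>; these are orthogonal with common length \<open>norm y\<close>, so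
  Pythagoras gives its length.\<close>

lemma grad_inner_norm_hinner_sq:
  fixes y :: "'k::hermitian_euclidean ^ 'n"
  shows "grad_inner (\<lambda>x. (norm (hinner x y))\<^sup>2) (\<lambda>x. (norm (hinner x y))\<^sup>2) =
    (\<lambda>x. 4 * (norm y)\<^sup>2 * (norm (hinner x y))\<^sup>2)"
proof
  fix x
  let ?g = "\<lambda>c. x \<bullet> hconj_shift y c"
  let ?z = "\<Sum>c\<in>Basis. ?g c *\<^sub>R hconj_shift y c"
  have "grad_inner (\<lambda>x. (norm (hinner x y))\<^sup>2) (\<lambda>x. (norm (hinner x y))\<^sup>2) x
      = (\<Sum>e\<in>Basis. 4 * ((e \<bullet> ?z) * (e \<bullet> ?z)))"
    by (simp add: grad_inner_def dir_deriv_norm_hinner_sq mult_ac del: inner_sum_right inner_scaleR_right)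
  also have "\<dots> = 4 * (?z \<bullet> ?z)"
    unfolding sum_distrib_left[symmetric] sum_Basis_inner ..
  also have "?z \<bullet> ?z = (\<Sum>c\<in>Basis. \<Sum>c'\<in>Basis. if c' = c then ?g c * ?g c * (norm y)\<^sup>2 else 0)"
    unfolding inner_sum_left inner_sum_right inner_scaleR_left inner_scaleR_right
      sum_distrib_left
    by (intro sum.cong refl) (simp add: inner_hconj_shift)
  also have "\<dots> = (norm y)\<^sup>2 * (norm (hinner x y))\<^sup>2"
    by (simp add: norm_hinner_sq_eq_sum sum_distrib_left power2_eq_square[of "?g _"] mult_ac)
  finally show "grad_inner (\<lambda>x. (norm (hinner x y))\<^sup>2) (\<lambda>x. (norm (hinner x y))\<^sup>2) x
      = 4 * (norm y)\<^sup>2 * (norm (hinner x y))\<^sup>2" by simp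
qed

text \<open>The form is a sum of \<open>DIM('k)\<close> squares of linear functionals; the square of
  a functional represented by \<open>v\<close> has Laplacian twice the squared length of
  \<open>v\<close>.\<close>

lemma laplacian_norm_hinner_sq:
  fixes y :: "'k::hermitian_euclidean ^ 'n"
  shows "laplacian (\<lambda>x. (norm (hinner x y))\<^sup>2) = (\<lambda>x. 2 * real DIM('k) * (norm y)\<^sup>2)"
proof
  fix x
  let ?s = "hconj_shift y"
  have "dir_deriv e (dir_deriv e (\<lambda>x. (norm (hinner x y))\<^sup>2)) x
      = (\<Sum>c\<in>Basis. 2 * ((e \<bullet> ?s c) * (e \<bullet> ?s c)))" for e
  proof -
    have "dir_deriv e (\<lambda>x. 2 * (e \<bullet> (\<Sum>c\<in>Basis. (x \<bullet> ?s c) *\<^sub>R ?s c)))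
       = (\<lambda>_. 2 * (e \<bullet> (\<Sum>c\<in>Basis. (e \<bullet> ?s c) *\<^sub>R ?s c)))"
      by (rule dir_deriv_linear) (intro bounded_linear_intros)
    then show ?thesis
      by (simp add: dir_deriv_norm_hinner_sq inner_sum_right sum_distrib_left)
  qed
  then have "laplacian (\<lambda>x. (norm (hinner x y))\<^sup>2) x
      = (\<Sum>c\<in>Basis. \<Sum>e\<in>Basis. 2 * ((e \<bullet> ?s c) * (e \<bullet> ?s c)))"
    unfolding laplacian_def by (simp only:) (rule sum.swap)
  also have "\<dots> = (\<Sum>c\<in>(Basis::'k set). 2 * (norm y)\<^sup>2)"
    unfolding sum_distrib_left[symmetric] sum_Basis_inner by (simp add: inner_hconj_shift)
  finally show "laplacian (\<lambda>x. (norm (hinner x y))\<^sup>2) x = 2 * real DIM('k) * (norm y)\<^sup>2"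
    by simp
qed

section \<open>Positive definiteness of the zonal functions\<close>

lemma laplacian_norm_hinner_sq_power:
  fixes y :: "'k::hermitian_euclidean ^ 'n"
  shows "laplacian (\<lambda>x. ((norm (hinner x y))\<^sup>2) ^ p) = (\<lambda>x. 2 * real p * (2 * real p + real DIM('k) - 2) *
    (norm y)\<^sup>2 * ((norm (hinner x y))\<^sup>2) ^ (p - 1))"
proof -
  have *: "real p * (real p - 1) * u ^ (p - 2) * (4 * n * u) = 4 * real p * (real p - 1) * n * u ^ (p - 1)"
    for u n :: real
  proof (cases "p \<le> 1")
    case True
    then have "p = 0 \<or> p = 1" by auto
    then show ?thesis by auto
  next
    case False
    then obtain q where "p = Suc (Suc q)" by (metis One_nat_def not_less_eq_eq not0_implies_Suc le0)
    then show ?thesis by simp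
  qed
  show ?thesis
    unfolding laplacian_power[OF real_polynomial_function_norm_hinner_sq] laplacian_norm_hinner_sq
      grad_inner_norm_hinner_sq *
    by (simp add: fun_eq_iff algebra_simps)
qed

text \<open>Each Laplacian trades one factor of the squared Hermitian product for a squared norm of
  \<open>y\<close>. Up to constants the iterates are thus the monomials of
  \<open>zonal_form_expand\<close>, with the roles of the arguments exchanged.\<close>

lemma funpow_laplacian_norm_hinner_sq_power:
  fixes y :: "'k::hermitian_euclidean ^ 'n"
  assumes "j \<le> k"
  shows "(laplacian ^^ j) (\<lambda>x. ((norm (hinner x y))\<^sup>2) ^ k) =
    (\<lambda>x. (\<Prod>i<j. 2 * real (k - i) * (2 * real (k - i) + real DIM('k) - 2)) *
      ((norm y)\<^sup>2) ^ j * ((norm (hinner x y))\<^sup>2) ^ (k - j))"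
  using assms
proof (induction j)
  case (Suc j)
  have "(laplacian ^^ Suc j) (\<lambda>x. ((norm (hinner x y))\<^sup>2) ^ k) = laplacian (\<lambda>x.
     ((\<Prod>i<j. 2 * real (k - i) * (2 * real (k - i) + real DIM('k) - 2)) *
      ((norm y)\<^sup>2) ^ j) * ((norm (hinner x y))\<^sup>2) ^ (k - j))"
    using Suc by simp
  also have "\<dots> = (\<lambda>x. ((\<Prod>i<j. 2 * real (k - i) * (2 * real (k - i) + real DIM('k) - 2)) *
      ((norm y)\<^sup>2) ^ j) * laplacian (\<lambda>x. ((norm (hinner x y))\<^sup>2) ^ (k - j)) x)"
    by (intro laplacian_cmult real_polynomial_function_power real_polynomial_function_norm_hinner_sq)
  finally show ?case
    unfolding laplacian_norm_hinner_sq_power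
    by (simp add: fun_eq_iff mult_ac)
qed simp

section \<open>Generalized binomials and Jacobi coefficients\<close>

lemma gbinomial_Suc_mult: "(a gchoose Suc j) * real (Suc j) = (a gchoose j) * (a - real j)" for a :: real
  by (simp add: gbinomial_prod_rev del: of_nat_Suc)

lemma gbinomial_pos: "a > real j - 1 \<Longrightarrow> 0 < a gchoose j" for a :: real
  unfolding gbinomial_prod_rev by (intro divide_pos_pos prod_pos) auto

text \<open>The coefficients of \<open>jacobi_poly\<close> in products of powers of
  \<open>(x - 1) / 2\<close> and \<open>(x + 1) / 2\<close>.\<close>

definition jacobi_coeff :: "real \<Rightarrow> real \<Rightarrow> nat \<Rightarrow> nat \<Rightarrow> real" where
  "jacobi_coeff \<alpha> \<beta> k s = ((real k + \<alpha>) gchoose (k - s)) * ((real k + \<beta>) gchoose s)"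

lemma jacobi_coeff_pos:
  assumes "\<alpha> > -1" "\<beta> > -1" "s \<le> k"
  shows "jacobi_coeff \<alpha> \<beta> k s > 0"
  unfolding jacobi_coeff_def using assms by (intro mult_pos_pos gbinomial_pos) (auto simp: of_nat_diff)

text \<open>This two-term recurrence is what cancels the Laplacian of
  \<open>zonal_form\<close>.\<close>

lemma jacobi_coeff_Suc:
  assumes "s < k"
  shows "jacobi_coeff \<alpha> \<beta> k (Suc s) * (real (Suc s) * (\<alpha> + real (Suc s))) =
    jacobi_coeff \<alpha> \<beta> k s * (real (k - s) * (\<beta> + real (k - s)))"
proof -
  obtain j where j: "k = Suc (s + j)"
    using assms less_iff_Suc_add by auto
  have 1: "((real k + \<alpha>) gchoose Suc j) * real (Suc j) = ((real k + \<alpha>) gchoose j) * (\<alpha> + real (Suc s))"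
    unfolding gbinomial_Suc_mult by (simp add: j algebra_simps)
  have 2: "((real k + \<beta>) gchoose Suc s) * real (Suc s) = ((real k + \<beta>) gchoose s) * (\<beta> + real (Suc j))"
    unfolding gbinomial_Suc_mult by (simp add: j algebra_simps)
  have 3: "k - s = Suc j" "k - Suc s = j"
    by (auto simp: j)
  have "jacobi_coeff \<alpha> \<beta> k (Suc s) * (real (Suc s) * (\<alpha> + real (Suc s))) =
     (((real k + \<alpha>) gchoose j) * (\<alpha> + real (Suc s))) * (((real k + \<beta>) gchoose Suc s) * real (Suc s))"
    unfolding jacobi_coeff_def 3 by (simp only: mult_ac)
  also have "\<dots> = jacobi_coeff \<alpha> \<beta> k s * (real (k - s) * (\<beta> + real (k - s)))"
    unfolding jacobi_coeff_def 3 1[symmetric] 2 by (simp only: mult_ac)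
  finally show ?thesis .
qed

text \<open>For a unit vector \<open>y\<close> this is, up to a positive factor, the zonal function of
  \<open>|\<langle>x, y\<rangle>|\<close> extended from the sphere to a homogeneous polynomial in \<open>x\<close>.\<close>

definition zonal_form :: "nat \<Rightarrow> 'k::hermitian_euclidean ^ 'n \<Rightarrow> 'k ^ 'n \<Rightarrow> real" where
  "zonal_form k x y = (\<Sum>s\<le>k.
     jacobi_coeff ((real CARD('n) - 1) * (real DIM('k) / 2) - 1) (real DIM('k) / 2 - 1) k s *
     (((norm (hinner x y))\<^sup>2 - (norm x)\<^sup>2) ^ s * ((norm (hinner x y))\<^sup>2) ^ (k - s)))"

lemma real_polynomial_function_zonal_form [intro]:
  "real_polynomial_function (\<lambda>x. zonal_form k x y)"
  unfolding zonal_form_def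
  by (intro real_polynomial_function_sum real_polynomial_function.intros(2,4) finite_atMost
    real_polynomial_function_power[OF real_polynomial_function_norm_hinner_sq]
    real_polynomial_function_power[OF real_polynomial_function_diff
      [OF real_polynomial_function_norm_hinner_sq real_polynomial_function_norm_sq]])

lemma zonal_eq_zonal_form:
  fixes x y :: "'k::hermitian_euclidean ^ 'n"
  assumes "norm x = 1"
  shows "zonal DIM('k) CARD('n) k (norm (hinner x y)) = zonal_form k x y /
    ((real k + ((real CARD('n) - 1) * (real DIM('k) / 2) - 1)) gchoose k)"
proof -
  \<comment> \<open>With \<open>t\<close> the squared Hermitian product, the two Jacobi factors
    become the bases of the powers in \<open>zonal_form\<close>, since
    \<open>norm x = 1\<close>.\<close>
  have "(2 * t - 1 - 1) / 2 = t - 1" "(2 * t - 1 + 1) / 2 = t" for t :: real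
    by simp_all
  then show ?thesis
    unfolding zonal_def Let_def poly_jacobi_poly_1
    by (simp only: poly_jacobi_poly zonal_form_def jacobi_coeff_def assms power_one mult.assoc)
qed

text \<open>For unit \<open>y\<close>, \<open>u\<close> is the squared length of the component of
  \<open>x\<close> along the line of \<open>y\<close>, and \<open>-w\<close> that of the orthogonal
  component. Their gradients are orthogonal, so the Laplacian of \<open>w ^ a * u ^ b\<close> has
  only two terms, and neighbouring summands cancel by \<open>jacobi_coeff_Suc\<close>.\<close>

lemma laplacian_zonal_form:
  fixes y :: "'k::hermitian_euclidean ^ 'n"
  assumes y: "norm y = 1"
  shows "laplacian (\<lambda>x. zonal_form k x y) = (\<lambda>_. 0)"
proof
  fix x :: "'k ^ 'n"
  define \<alpha> where "\<alpha> = (real CARD('n) - 1) * (real DIM('k) / 2) - 1"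
  define \<beta> where "\<beta> = real DIM('k) / 2 - 1"
  define u where "u = (\<lambda>x. (norm (hinner x y))\<^sup>2)"
  define w where "w = (\<lambda>x. (norm (hinner x y))\<^sup>2 - (norm x)\<^sup>2)"
  define r where "r = (\<lambda>x :: 'k ^ 'n. (norm x)\<^sup>2)"
  have poly [intro]: "real_polynomial_function u" "real_polynomial_function w" "real_polynomial_function r"
    by (auto simp: u_def w_def r_def)
  have w: "w = (\<lambda>x. u x + (-1) * r x)"
    by (simp add: w_def u_def r_def)
  have u: "laplacian u = (\<lambda>x. 4 * (\<beta> + 1))" "grad_inner u u = (\<lambda>x. 4 * u x)"
      "laplacian r = (\<lambda>x. 2 * real DIM('k) * real CARD('n))"
      "grad_inner r r = (\<lambda>x. 4 * r x)" "grad_inner r u = (\<lambda>x. 4 * u x)"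
    by (simp_all add: u_def r_def \<beta>_def laplacian_norm_hinner_sq grad_inner_norm_hinner_sq y
      laplacian_norm_sq grad_inner_norm_sq grad_inner_norm_sq_norm_hinner_sq mult_ac)
  have r': "real_polynomial_function (\<lambda>x. (-1) * r x)"
    by (intro real_polynomial_function.intros(2,4) poly)
  have dw: "dir_deriv e w = (\<lambda>x. dir_deriv e u x - dir_deriv e r x)" for e
    unfolding w dir_deriv_add[OF poly(1) r'] dir_deriv_mult[OF real_polynomial_function.intros(2) poly(3)]
      dir_deriv_const by simp
  have wu: "grad_inner w f = (\<lambda>x. grad_inner u f x - grad_inner r f x)" for f
    by (simp add: grad_inner_def dw fun_eq_iff algebra_simps sum_subtractf)
  have w1: "grad_inner w u = (\<lambda>x. 0)"
    by (simp add: wu u)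
  have w2: "grad_inner w w = (\<lambda>x. -4 * w x)"
    unfolding wu grad_inner_commute[of u w] grad_inner_commute[of r w] grad_inner_commute[of u r] u by (simp add: fun_eq_iff w)
  \<comment> \<open>The orthogonal complement of the line has real dimension
    \<open>2 * (\<alpha> + 1)\<close>, the line itself \<open>2 * (\<beta> + 1)\<close>.\<close>
  have w3: "laplacian w = (\<lambda>x. -4 * (\<alpha> + 1))"
  proof -
    have lw: "laplacian w = (\<lambda>x. laplacian u x + (-1) * laplacian r x)"
      unfolding w laplacian_add[OF poly(1) r'] laplacian_cmult[OF poly(3)] ..
    show ?thesis
      unfolding lw u \<alpha>_def \<beta>_def by (rule ext) (simp add: field_simps)
  qed
  have pow: "real a * (real a - 1) * z ^ (a - 2) * z = real a * (real a - 1) * z ^ (a - 1)" for a and z :: real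
  proof (cases "a \<le> 1")
    case True
    then have "a = 0 \<or> a = 1" by auto
    then show ?thesis by auto
  next
    case False
    then obtain b where "a = Suc (Suc b)" by (metis One_nat_def not_less_eq_eq not0_implies_Suc le0)
    then show ?thesis by simp
  qed
  have L: "laplacian (\<lambda>x. w x ^ a * u x ^ b) x =
      4 * (real b * (\<beta> + real b)) * (w x ^ a * u x ^ (b - 1))
      - 4 * (real a * (\<alpha> + real a)) * (w x ^ (a - 1) * u x ^ b)" for a b
  proof -
    have "grad_inner (\<lambda>x. w x ^ a) (\<lambda>x. u x ^ b) x = 0"
      using poly by (simp add: grad_inner_power_left grad_inner_commute[of w "\<lambda>x. u x ^ b"]
        grad_inner_commute[of u w] w1)
    moreover have "laplacian (\<lambda>x. w x ^ a) x = -4 * (real a * (\<alpha> + real a)) * w x ^ (a - 1)"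
      using poly pow[of a "w x"] by (simp add: laplacian_power w2 w3 algebra_simps)
    moreover have "laplacian (\<lambda>x. u x ^ b) x = 4 * (real b * (\<beta> + real b)) * u x ^ (b - 1)"
      using poly pow[of b "u x"] by (simp add: laplacian_power u algebra_simps)
    moreover have "real_polynomial_function (\<lambda>x. w x ^ a)" "real_polynomial_function (\<lambda>x. u x ^ b)"
      using poly by auto
    ultimately show ?thesis
      by (simp add: laplacian_mult)
  qed
  let ?A = "jacobi_coeff \<alpha> \<beta> k"
  have "laplacian (\<lambda>x. zonal_form k x y) x = (\<Sum>s\<le>k. ?A s * laplacian (\<lambda>x. w x ^ s * u x ^ (k - s)) x)"
  proof -
    have p: "real_polynomial_function (\<lambda>x. w x ^ s * u x ^ (k - s))" for s
      using poly by auto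
    have "laplacian (\<lambda>x. \<Sum>s\<le>k. ?A s * (w x ^ s * u x ^ (k - s))) =
      (\<lambda>x. \<Sum>s\<le>k. laplacian (\<lambda>x. ?A s * (w x ^ s * u x ^ (k - s))) x)"
      by (rule laplacian_sum) (intro real_polynomial_function.intros(2,4) p)
    then show ?thesis
      unfolding laplacian_cmult[OF p]
      by (simp add: zonal_form_def \<alpha>_def \<beta>_def w_def u_def)
  qed
  also have "\<dots> = 4 * ((\<Sum>s\<le>k. ?A s * (real (k - s) * (\<beta> + real (k - s))) * (w x ^ s * u x ^ (k - s - 1)))
      - (\<Sum>s\<le>k. ?A s * (real s * (\<alpha> + real s)) * (w x ^ (s - 1) * u x ^ (k - s))))"
    unfolding L sum_subtractf[symmetric] sum_distrib_left
    by (intro sum.cong refl) (simp add: algebra_simps)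
  \<comment> \<open>The summand \<open>s = k\<close> on the left and the summand
    \<open>s = 0\<close> on the right vanish; the others agree after shifting \<open>s\<close> by
    one.\<close>
  also have "(\<Sum>s\<le>k. ?A s * (real (k - s) * (\<beta> + real (k - s))) * (w x ^ s * u x ^ (k - s - 1)))
      = (\<Sum>s\<le>k. ?A s * (real s * (\<alpha> + real s)) * (w x ^ (s - 1) * u x ^ (k - s)))"
  proof (cases k)
    case (Suc n)
    have "(\<Sum>s\<le>k. ?A s * (real (k - s) * (\<beta> + real (k - s))) * (w x ^ s * u x ^ (k - s - 1)))
        = (\<Sum>s\<le>n. ?A s * (real (k - s) * (\<beta> + real (k - s))) * (w x ^ s * u x ^ (k - s - 1)))"
      by (simp add: Suc)
    also have "\<dots> = (\<Sum>s\<le>n. ?A (Suc s) * (real (Suc s) * (\<alpha> + real (Suc s))) * (w x ^ (Suc s - 1) * u x ^ (k - Suc s)))"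
      by (intro sum.cong refl) (subst jacobi_coeff_Suc, auto simp: Suc)
    also have "\<dots> = (\<Sum>s\<le>k. ?A s * (real s * (\<alpha> + real s)) * (w x ^ (s - 1) * u x ^ (k - s)))"
      unfolding Suc by (subst sum.atMost_Suc_shift) simp
    finally show ?thesis .
  qed simp
  finally show "laplacian (\<lambda>x. zonal_form k x y) x = 0"
    by simp
qed

section \<open>Harmonic projection of the kernel powers\<close>

lemma funpow_laplacian_lincomb:
  assumes "\<And>g. g \<in> G \<Longrightarrow> real_polynomial_function (f g)"
  shows "(laplacian ^^ j) (\<lambda>x. \<Sum>g\<in>G. c g * f g x) = (\<lambda>x. \<Sum>g\<in>G. c g * (laplacian ^^ j) (f g) x)"
proof (induction j)
  case (Suc j)
  have p: "real_polynomial_function ((laplacian ^^ j) (f g))" if "g \<in> G" for g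
    using assms[OF that] by auto
  have "(laplacian ^^ Suc j) (\<lambda>x. \<Sum>g\<in>G. c g * f g x) = laplacian (\<lambda>x. \<Sum>g\<in>G. c g * (laplacian ^^ j) (f g) x)"
    using Suc by simp
  also have "\<dots> = (\<lambda>x. \<Sum>g\<in>G. laplacian (\<lambda>x. c g * (laplacian ^^ j) (f g) x) x)"
    using p by (intro laplacian_sum) auto
  also have "\<dots> = (\<lambda>x. \<Sum>g\<in>G. c g * laplacian ((laplacian ^^ j) (f g)) x)"
    by (intro ext sum.cong refl) (simp add: laplacian_cmult p)
  finally show ?case by simp
qed simp

text \<open>The binomial theorem, with terms collected by powers of the squared norm of
  \<open>x\<close>, exposes the coefficients that the operator \<open>T\<close> below must
  reproduce.\<close>

lemma zonal_form_expand:
  fixes x y :: "'k::hermitian_euclidean ^ 'n"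
  shows "zonal_form k x y = (\<Sum>j\<le>k. ((-1) ^ j * (\<Sum>s\<le>k.
     jacobi_coeff ((real CARD('n) - 1) * (real DIM('k) / 2) - 1) (real DIM('k) / 2 - 1) k s * real (s choose j)))
    * (((norm x)\<^sup>2) ^ j * ((norm (hinner x y))\<^sup>2) ^ (k - j)))"
proof -
  define A where "A = jacobi_coeff ((real CARD('n) - 1) * (real DIM('k) / 2) - 1) (real DIM('k) / 2 - 1) k"
  define u where "u = (norm (hinner x y))\<^sup>2"
  define r where "r = (norm x)\<^sup>2"
  have "zonal_form k x y = (\<Sum>s\<le>k. \<Sum>j\<le>k. A s * (real (s choose j) * ((-1) ^ j * (r ^ j * u ^ (k - j)))))"
    unfolding zonal_form_def A_def[symmetric] u_def[symmetric] r_def[symmetric]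
  proof (intro sum.cong refl)
    fix s assume "s \<in> {..k}"
    then have s: "s \<le> k" by simp
    have "(u - r) ^ s = (\<Sum>j\<le>s. real (s choose j) * (- r) ^ j * u ^ (s - j))"
      using binomial_ring[of "- r" u s] by simp
    also have "\<dots> * u ^ (k - s) = (\<Sum>j\<le>s. real (s choose j) * ((-1) ^ j * (r ^ j * u ^ (k - j))))"
      unfolding sum_distrib_right
    proof (intro sum.cong refl)
      fix j assume "j \<in> {..s}"
      then have "u ^ (k - j) = u ^ (s - j) * u ^ (k - s)"
        using s by (simp flip: power_add)
      moreover have "(- r) ^ j = (-1) ^ j * r ^ j"
        by (rule power_minus)
      ultimately show "real (s choose j) * (- r) ^ j * u ^ (s - j) * u ^ (k - s)
          = real (s choose j) * ((-1) ^ j * (r ^ j * u ^ (k - j)))"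
        by (simp only: mult_ac)
    qed
    \<comment> \<open>Since \<open>s choose j = 0\<close> for \<open>j > s\<close>, the range can be
      made independent of \<open>s\<close>, which permits swapping the sums.\<close>
    also have "\<dots> = (\<Sum>j\<le>k. real (s choose j) * ((-1) ^ j * (r ^ j * u ^ (k - j))))"
      using s by (intro sum.mono_neutral_left) auto
    finally show "A s * ((u - r) ^ s * u ^ (k - s)) = (\<Sum>j\<le>k. A s * (real (s choose j) * ((-1) ^ j * (r ^ j * u ^ (k - j)))))"
      by (simp add: sum_distrib_left)
  qed
  also have "\<dots> = (\<Sum>j\<le>k. ((-1) ^ j * (\<Sum>s\<le>k. A s * real (s choose j))) * (r ^ j * u ^ (k - j)))"
    by (subst sum.swap) (simp only: sum_distrib_left sum_distrib_right mult_ac)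
  finally show ?thesis
    unfolding A_def u_def r_def .
qed

text \<open>Tensor power of the features: expanding the product of \<open>k\<close> equal sums gives
  one term for each function \<open>g\<close> that picks a feature for every factor.\<close>

lemma norm_hinner_power_features:
  obtains G :: "(nat \<Rightarrow> 'n::finite \<times> 'n \<times> 'k::hermitian_euclidean) set"
    and f :: "(nat \<Rightarrow> 'n \<times> 'n \<times> 'k) \<Rightarrow> 'k ^ 'n \<Rightarrow> real"
  where "finite G" "\<And>g. g \<in> G \<Longrightarrow> real_polynomial_function (f g)"
    "\<And>x y. ((norm (hinner x y))\<^sup>2) ^ k = (\<Sum>g\<in>G. f g x * f g y)"
proof -
  define I where "I = (UNIV :: 'n set) \<times> (UNIV :: 'n set) \<times> (Basis :: 'k set)"
  define \<phi> where "\<phi> = (\<lambda>(i, j, c) (x :: 'k ^ 'n). (c * x $ i) \<bullet> x $ j)"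
  have fin: "finite I" by (simp add: I_def)
  have 1: "(norm (hinner x y))\<^sup>2 = (\<Sum>p\<in>I. \<phi> p x * \<phi> p y)" for x y :: "'k ^ 'n"
    unfolding norm_hinner_sq_features I_def \<phi>_def sum.cartesian_product by (simp add: case_prod_beta)
  have p: "real_polynomial_function (\<phi> p)" for p
  proof -
    obtain i j c where p: "p = (i, j, c)" by (cases p)
    have eq: "\<phi> p = (\<lambda>x. \<Sum>b\<in>Basis. ((c * x $ i) \<bullet> b) * (x $ j \<bullet> b))"
      unfolding \<phi>_def p prod.case by (rule ext) (rule euclidean_inner)
    show ?thesis
      unfolding eq
      by (intro real_polynomial_function_sum real_polynomial_function.intros(4) 
        real_polynomial_function.intros(1) finite_Basis
        bounded_linear_compose[OF bounded_linear_inner_left]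
        bounded_linear_compose[OF bounded_linear_mult_right] bounded_linear_vec_nth)
  qed
  define f where "f g x = (\<Prod>i<k. \<phi> (g i) x)" for g :: "nat \<Rightarrow> 'n \<times> 'n \<times> 'k" and x
  show ?thesis
  proof (rule that)
    show "finite (PiE {..<k} (\<lambda>_. I))"
      using fin by (intro finite_PiE) auto
    show "real_polynomial_function (f g)" for g
      unfolding f_def[abs_def] by (intro real_polynomial_function_prod p) auto
    show "((norm (hinner x y))\<^sup>2) ^ k = (\<Sum>g\<in>PiE {..<k} (\<lambda>_. I). f g x * f g y)" for x y
    proof -
      have "((norm (hinner x y))\<^sup>2) ^ k = (\<Prod>i<k. \<Sum>p\<in>I. \<phi> p x * \<phi> p y)"
        by (simp add: 1)
      also have "\<dots> = (\<Sum>g\<in>PiE {..<k} (\<lambda>_. I). \<Prod>i<k. \<phi> (g i) x * \<phi> (g i) y)"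
        by (rule prod_sum_PiE) (use fin in auto)
      finally show ?thesis
        by (simp add: f_def prod.distrib)
    qed
  qed
qed

lemma zonal_form_positive_definite:
  fixes e :: "'i \<Rightarrow> 'k::hermitian_euclidean ^ 'n"
  assumes "finite I" and e: "\<And>i. i \<in> I \<Longrightarrow> norm (e i) = 1" and d: "2 \<le> CARD('n)"
  shows "0 \<le> (\<Sum>i\<in>I. \<Sum>j\<in>I. w i * w j * zonal_form k (e i) (e j))"
proof -
  define A where "A = jacobi_coeff ((real CARD('n) - 1) * (real DIM('k) / 2) - 1) (real DIM('k) / 2 - 1) k"
  \<comment> \<open>\<open>E\<close> holds the coefficients from \<open>zonal_form_expand\<close>,
    and \<open>C j\<close> is the constant that \<open>j\<close> Laplacians bring out of the
    \<open>k\<close>-th kernel power, so \<open>T\<close> divides by it.\<close>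
  define E where "E j = (-1) ^ j * (\<Sum>s\<le>k. A s * real (s choose j))" for j
  define C where "C j = (\<Prod>i<j. 2 * real (k - i) * (2 * real (k - i) + real DIM('k) - 2))" for j
  txt \<open>\<open>T\<close> sends \<open>|\<langle>x, \<cdot>\<rangle>|\<^bsup>2k\<^esup>\<close> to a multiple of its harmonic part and multiplies harmonic functions by \<open>E 0\<close>.
    Applied in both variables to the sum-of-products expansion of this kernel it yields a sum of
    squares.\<close>
  define T where "T \<phi> x = (\<Sum>j\<le>k. E j / C j * (laplacian ^^ j) \<phi> x)" for \<phi> and x :: "'k ^ 'n"
  have dim: "0 < real DIM('k)" by simp
  \<comment> \<open>\<open>E 0\<close> is the sum of all Jacobi coefficients; dimension at least 2
    puts the first Jacobi parameter above \<open>-1\<close>.\<close>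
  have E0: "E 0 > 0"
  proof -
    have "(real CARD('n) - 1) * (real DIM('k) / 2) > 0"
      using d dim by (intro mult_pos_pos) auto
    then show ?thesis
      unfolding E_def A_def using dim by (simp, intro sum_pos jacobi_coeff_pos) auto
  qed
  have C: "C j \<noteq> 0" if "j \<le> k" for j
  proof -
    have "2 * real (k - i) * (2 * real (k - i) + real DIM('k) - 2) > 0" if "i < j" for i
    proof -
      have "real (k - i) \<ge> 1" using that \<open>j \<le> k\<close> by simp
      then show ?thesis using dim by (intro mult_pos_pos) linarith+
    qed
    then show ?thesis
      unfolding C_def by (intro less_imp_neq[symmetric] prod_pos) auto
  qed
  obtain G and f :: "(nat \<Rightarrow> 'n \<times> 'n \<times> 'k) \<Rightarrow> 'k ^ 'n \<Rightarrow> real"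
    where G: "finite G" "\<And>g. g \<in> G \<Longrightarrow> real_polynomial_function (f g)"
      "\<And>x y. ((norm (hinner x y))\<^sup>2) ^ k = (\<Sum>g\<in>G. f g x * f g y)"
    by (rule norm_hinner_power_features[where k = k]) (rule that; assumption)
  have lap_lincomb: "(laplacian ^^ j) (\<lambda>x. \<Sum>g\<in>G. c g * f g x)
      = (\<lambda>x. \<Sum>g\<in>G. c g * (laplacian ^^ j) (f g) x)" for j c
    using G(2) by (rule funpow_laplacian_lincomb)
  have T_lincomb: "T (\<lambda>x. \<Sum>g\<in>G. c g * f g x) z = (\<Sum>g\<in>G. c g * T (f g) z)" for c z
    unfolding T_def lap_lincomb sum_distrib_left
    by (subst sum.swap) (simp only: mult_ac)
  \<comment> \<open>\<open>T\<close> acts on the second variable with \<open>x\<close> fixed,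
    whereas harmonicity is used below in the first variable.\<close>
  have Z: "zonal_form k x y = (\<Sum>g\<in>G. f g x * T (f g) y)" for x y
  proof -
    have "T (\<lambda>z. ((norm (hinner z x))\<^sup>2) ^ k) y = zonal_form k x y"
      unfolding T_def zonal_form_expand
    proof (intro sum.cong refl)
      fix j assume "j \<in> {..k}"
      then have j: "j \<le> k" by simp
      show "E j / C j * (laplacian ^^ j) (\<lambda>z. ((norm (hinner z x))\<^sup>2) ^ k) y =
        ((-1) ^ j * (\<Sum>s\<le>k. jacobi_coeff ((real CARD('n) - 1) * (real DIM('k) / 2) - 1) (real DIM('k) / 2 - 1) k s
           * real (s choose j))) * (((norm x)\<^sup>2) ^ j * ((norm (hinner x y))\<^sup>2) ^ (k - j))"
        unfolding funpow_laplacian_norm_hinner_sq_power[OF j] A_def[symmetric] E_def[symmetric]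
          C_def[symmetric] norm_hinner_commute[of y x]
        using C[OF j] by simp
    qed
    also have "(\<lambda>z. ((norm (hinner z x))\<^sup>2) ^ k) = (\<lambda>z. \<Sum>g\<in>G. f g x * f g z)"
      unfolding G(3) by (simp only: mult.commute)
    finally show ?thesis
      unfolding T_lincomb by simp
  qed
  define F where "F x = (\<Sum>i\<in>I. w i * zonal_form k x (e i))" for x
  define c where "c g = (\<Sum>i\<in>I. w i * T (f g) (e i))" for g
  have F: "F x = (\<Sum>g\<in>G. c g * f g x)" for x
    unfolding F_def c_def Z sum_distrib_left sum_distrib_right
    by (subst sum.swap) (simp only: mult_ac)
  have "laplacian F = (\<lambda>x. \<Sum>i\<in>I. w i * laplacian (\<lambda>x. zonal_form k x (e i)) x)"
    using funpow_laplacian_lincomb[of I "\<lambda>i x. zonal_form k x (e i)" 1 w]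
    by (simp add: F_def[abs_def] real_polynomial_function_zonal_form)
  then have lap: "laplacian F = (\<lambda>x. 0)"
    by (simp add: laplacian_zonal_form e)
  have "(laplacian ^^ j) F = (\<lambda>x. 0)" if "j > 0" for j
    using that
  proof (induction j)
    case (Suc j)
    then show ?case by (cases "j = 0") (simp_all add: lap)
  qed simp
  \<comment> \<open>\<open>F\<close> is harmonic, so only \<open>j = 0\<close> survives, where
    \<open>C 0 = 1\<close> as an empty product.\<close>
  then have "T F x = (\<Sum>j\<le>k. if j = 0 then E 0 * F x else 0)" for x
    unfolding T_def by (intro sum.cong) (auto simp: C_def)
  then have TF: "T F x = E 0 * F x" for x
    by simp
  \<comment> \<open>The sum over \<open>i\<close> produces \<open>c g\<close> a second time, next to
    the one already in the expansion of \<open>F\<close>; this makes the squares.\<close>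
  have "E 0 * (\<Sum>i\<in>I. \<Sum>j\<in>I. w i * w j * zonal_form k (e i) (e j)) = (\<Sum>i\<in>I. w i * T F (e i))"
    unfolding TF F_def by (simp add: sum_distrib_left mult_ac)
  also have "\<dots> = (\<Sum>i\<in>I. w i * (\<Sum>g\<in>G. c g * T (f g) (e i)))"
    unfolding F[abs_def] T_lincomb ..
  also have "\<dots> = (\<Sum>g\<in>G. c g * (\<Sum>i\<in>I. w i * T (f g) (e i)))"
    unfolding sum_distrib_left by (subst sum.swap) (simp only: mult_ac)
  also have "\<dots> = (\<Sum>g\<in>G. (c g)\<^sup>2)"
    by (simp add: c_def power2_eq_square)
  also have "\<dots> \<ge> 0"
    by (simp add: sum_nonneg)
  finally show ?thesis
    using E0 by (simp add: zero_le_mult_iff)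
qed

lemma zonal_positive_definite:
  fixes e :: "'i \<Rightarrow> 'k::hermitian_euclidean ^ 'n"
  assumes "finite I" and e: "\<And>i. i \<in> I \<Longrightarrow> norm (e i) = 1" and d: "2 \<le> CARD('n)"
  shows "0 \<le> (\<Sum>i\<in>I. \<Sum>j\<in>I. w i * w j * zonal DIM('k) CARD('n) k (norm (hinner (e i) (e j))))"
proof -
  let ?P = "(real k + ((real CARD('n) - 1) * (real DIM('k) / 2) - 1)) gchoose k"
  have "(real CARD('n) - 1) * (real DIM('k) / 2) > 0"
    using d by (intro mult_pos_pos) auto
  then have "?P > 0"
    by (intro gbinomial_pos) simp
  moreover have "(\<Sum>i\<in>I. \<Sum>j\<in>I. w i * w j * zonal DIM('k) CARD('n) k (norm (hinner (e i) (e j))))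
      = (\<Sum>i\<in>I. \<Sum>j\<in>I. w i * w j * zonal_form k (e i) (e j)) / ?P"
    unfolding sum_divide_distrib by (intro sum.cong refl) (simp add: zonal_eq_zonal_form e)
  ultimately show ?thesis
    using zonal_form_positive_definite[OF assms] by simp
qed

section \<open>Tight frames\<close>

text \<open>Weighted AM-GM for \<open>x\<close> and \<open>1\<close>. At \<open>x = 0\<close> the
  left side is \<open>0\<close> even for \<open>p = 0\<close>, as
  \<open>0 powr 0 = 0\<close>.\<close>

lemma powr_le_affine:
  fixes x p :: real
  assumes "0 \<le> x" "0 \<le> p" "p \<le> 1"
  shows "x powr p \<le> 1 + p * (x - 1)"
proof (cases "x = 0")
  case False
  then show ?thesis
    using Youngs_inequality_0[of p "1 - p" x 1] assms by (simp add: algebra_simps)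
qed (use assms in simp)

text \<open>The preceding inequality for \<open>x powr p\<close> with exponent \<open>1 / p\<close>,
  solved for \<open>x powr p\<close>.\<close>

lemma powr_ge_affine:
  fixes x p :: real
  assumes "0 \<le> x" "1 \<le> p"
  shows "1 + p * (x - 1) \<le> x powr p"
proof (cases "x = 0")
  case False
  then have "x \<le> 1 + 1 / p * (x powr p - 1)"
    using powr_le_affine[of "x powr p" "1 / p"] assms by (simp add: powr_powr)
  then show ?thesis
    using assms by (simp add: field_simps)
qed (use assms in simp)

lemma sum_off_diagonal:
  fixes f :: "'i \<Rightarrow> 'i \<Rightarrow> 'a::ab_group_add"
  assumes "finite I"
  shows "(\<Sum>i\<in>I. \<Sum>j\<in>I - {i}. f i j) = (\<Sum>i\<in>I. \<Sum>j\<in>I. f i j) - (\<Sum>i\<in>I. f i i)"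
  using assms by (simp add: sum_diff1 sum_subtractf)

text \<open>The series converges at each of the finitely many pairs, so it may be summed termwise;
  each term is a nonpositive coefficient times a nonnegative quadratic form.\<close>

lemma sum_majorant_le:
  fixes e :: "nat \<Rightarrow> 'k::hermitian_euclidean ^ 'n"
  assumes d: "2 \<le> CARD('n)" and fin: "finite I" and e: "\<And>i. i \<in> I \<Longrightarrow> norm (e i) = 1"
    and a: "\<And>k. 2 \<le> k \<Longrightarrow> a k \<le> 0" and maj: "powr_majorized DIM('k) CARD('n) q a"
  shows "(\<Sum>i\<in>I. \<Sum>j\<in>I. w i * w j * majorant DIM('k) CARD('n) a (norm (hinner (e i) (e j))))
    \<le> a 0 * (\<Sum>i\<in>I. w i)\<^sup>2 + a 1 * (\<Sum>i\<in>I. \<Sum>j\<in>I. w i * w j * (norm (hinner (e i) (e j)))\<^sup>2)"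
proof -
  define t where "t i j = norm (hinner (e i) (e j))" for i j
  define Q where "Q k i j = zonal DIM('k) CARD('n) k (t i j)" for k i j
  have t: "t i j \<in> {0..1}" if "i \<in> I" "j \<in> I" for i j
    using norm_hinner_le[of "e i" "e j"] e that by (simp add: t_def)
  have "(\<lambda>k. a (k + 2) * Q (k + 2) i j) sums (\<Sum>k. a (k + 2) * Q (k + 2) i j)" if "i \<in> I" "j \<in> I" for i j
    using maj t[OF that] by (auto simp: powr_majorized_def Q_def intro!: summable_sums)
  then have "(\<lambda>k. \<Sum>i\<in>I. \<Sum>j\<in>I. w i * w j * (a (k + 2) * Q (k + 2) i j)) sums
      (\<Sum>i\<in>I. \<Sum>j\<in>I. w i * w j * (\<Sum>k. a (k + 2) * Q (k + 2) i j))"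
    by (intro sums_sum sums_mult)
  moreover have "(\<Sum>i\<in>I. \<Sum>j\<in>I. w i * w j * (a (k + 2) * Q (k + 2) i j)) \<le> 0" for k
  proof -
    have "(\<Sum>i\<in>I. \<Sum>j\<in>I. w i * w j * (a (k + 2) * Q (k + 2) i j))
        = a (k + 2) * (\<Sum>i\<in>I. \<Sum>j\<in>I. w i * w j * Q (k + 2) i j)"
      by (simp only: sum_distrib_left mult_ac)
    then show ?thesis
      using a[of "k + 2"] zonal_positive_definite[OF fin e d, where w = w and k = "k + 2"]
      by (simp add: Q_def t_def mult_nonpos_nonneg)
  qed
  ultimately have "(\<Sum>i\<in>I. \<Sum>j\<in>I. w i * w j * (\<Sum>k. a (k + 2) * Q (k + 2) i j)) \<le> 0"
    by (rule sums_le[OF _ _ sums_zero, rotated])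
  moreover have "(\<Sum>i\<in>I. \<Sum>j\<in>I. w i * w j * majorant DIM('k) CARD('n) a (t i j))
      = a 0 * (\<Sum>i\<in>I. w i)\<^sup>2 + a 1 * (\<Sum>i\<in>I. \<Sum>j\<in>I. w i * w j * (t i j)\<^sup>2)
        + (\<Sum>i\<in>I. \<Sum>j\<in>I. w i * w j * (\<Sum>k. a (k + 2) * Q (k + 2) i j))"
  proof -
    have "a 0 * (\<Sum>i\<in>I. w i)\<^sup>2 = (\<Sum>i\<in>I. \<Sum>j\<in>I. a 0 * (w i * w j))"
      unfolding power2_eq_square sum_product unfolding sum_distrib_left ..
    then show ?thesis
      by (simp add: majorant_def Q_def sum_distrib_left distrib_left sum.distrib mult_ac)
  qed
  ultimately show ?thesis
    by (simp add: t_def)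
qed

text \<open>AM-GM splits each term into two, exchanged by swapping \<open>i\<close> and
  \<open>j\<close>. The frame identity at \<open>e i\<close> evaluates the inner sum, and
  Bernoulli's inequality with exponent \<open>q - 1\<close> bounds the outer one.\<close>

lemma tight_frame_weighted_sum_le:
  fixes y e :: "nat \<Rightarrow> 'k::hermitian_euclidean ^ 'n"
  assumes q: "1 \<le> q" "q \<le> 2" and frame: "tight_frame N y (real N / real CARD('n))"
    and e: "\<And>i. norm (e i) = 1" and y: "\<And>i. y i = norm (y i) *\<^sub>R e i"
  shows "(\<Sum>i=1..N. \<Sum>j=1..N. norm (y i) powr q * norm (y j) powr q * (norm (hinner (e i) (e j)))\<^sup>2)
    \<le> (real N)\<^sup>2 / real CARD('n)"
proof -
  define r where "r i = norm (y i)" for i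
  define t where "t i j = norm (hinner (e i) (e j))" for i j
  have r: "r i \<ge> 0" for i
    by (simp add: r_def)
  have rq: "r i powr q = r i powr (q - 1) * r i" for i
    using powr_mult_power[of "r i" "q - 1" 1] r by simp
  have rq': "(r i powr (q - 1))\<^sup>2 \<le> 1 + (q - 1) * ((r i)\<^sup>2 - 1)" for i
  proof -
    have "(r i powr (q - 1))\<^sup>2 = (r i)\<^sup>2 powr (q - 1)"
      using r by (simp add: power2_eq_square powr_mult)
    then show ?thesis
      using powr_le_affine[of "(r i)\<^sup>2" "q - 1"] q by simp
  qed
  have frame_e: "(\<Sum>j=1..N. (r j * t i j)\<^sup>2) = real N / real CARD('n)" for i
  proof -
    have "r j * t i j = norm (hinner (e i) (y j))" for j
      by (subst y[of j]) (simp add: r_def t_def hinner_scaleR_right)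
    then show ?thesis
      using frame e[of i] by (simp add: tight_frame_def)
  qed
  have sum_r: "(\<Sum>i=1..N. (r i)\<^sup>2) = real N"
    using sum_norm_sq_tight_frame[OF frame] by (simp add: r_def)
  define S where "S = (\<Sum>i=1..N. \<Sum>j=1..N. (r i powr (q - 1))\<^sup>2 * (r j * t i j)\<^sup>2)"
  have "S = (\<Sum>i=1..N. (r i powr (q - 1))\<^sup>2) * (real N / real CARD('n))"
    by (simp only: S_def frame_e flip: sum_distrib_left sum_distrib_right)
  also have "\<dots> \<le> (\<Sum>i=1..N. 1 + (q - 1) * ((r i)\<^sup>2 - 1)) * (real N / real CARD('n))"
    by (intro mult_right_mono sum_mono rq') simp
  \<comment> \<open>The frame constant makes the mean of the squared norms \<open>1\<close>, so the
    linear terms cancel.\<close>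
  also have "(\<Sum>i=1..N. 1 + (q - 1) * ((r i)\<^sup>2 - 1)) = real N"
    using sum_r by (simp add: sum.distrib sum_subtractf flip: sum_distrib_left)
  finally have S: "S \<le> (real N)\<^sup>2 / real CARD('n)"
    by (simp add: power2_eq_square)
  have S': "(\<Sum>i=1..N. \<Sum>j=1..N. (r j powr (q - 1))\<^sup>2 * (r i * t i j)\<^sup>2) = S"
    unfolding S_def by (subst sum.swap) (simp add: t_def norm_hinner_commute)
  have "(\<Sum>i=1..N. \<Sum>j=1..N. r i powr q * r j powr q * (t i j)\<^sup>2) \<le>
      (\<Sum>i=1..N. \<Sum>j=1..N. ((r i powr (q - 1))\<^sup>2 * (r j * t i j)\<^sup>2 + (r j powr (q - 1))\<^sup>2 * (r i * t i j)\<^sup>2) / 2)"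
  proof (intro sum_mono)
    fix i j
    have "2 * (r i powr (q - 1) * (r j * t i j)) * (r j powr (q - 1) * (r i * t i j)) \<le>
       (r i powr (q - 1) * (r j * t i j))\<^sup>2 + (r j powr (q - 1) * (r i * t i j))\<^sup>2"
      by (rule sum_squares_bound)
    then show "r i powr q * r j powr q * (t i j)\<^sup>2 \<le>
      ((r i powr (q - 1))\<^sup>2 * (r j * t i j)\<^sup>2 + (r j powr (q - 1))\<^sup>2 * (r i * t i j)\<^sup>2) / 2"
      unfolding rq by (simp add: power_mult_distrib) (simp add: power2_eq_square mult_ac)
  qed
  also have "\<dots> = (S + S) / 2"
    unfolding sum_divide_distrib[symmetric] sum.distrib S' S_def ..
  finally show ?thesis
    using S by (simp add: r_def t_def)
qed

lemma tight_frame_powr_sum_le: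
  fixes y :: "nat \<Rightarrow> 'k::hermitian_euclidean ^ 'n" and q :: real
  assumes d: "2 \<le> CARD('n)" and q: "1 \<le> q" "q \<le> 2"
    and a: "0 \<le> a 0" "0 \<le> a 1" "\<And>k. 2 \<le> k \<Longrightarrow> a k \<le> 0"
    and maj: "powr_majorized DIM('k) CARD('n) q a"
    and frame: "tight_frame N y (real N / real CARD('n))"
  shows "(\<Sum>i\<in>{1..N}. \<Sum>j\<in>{1..N} - {i}. norm (hinner (y i) (y j)) powr q)
    \<le> (real N)\<^sup>2 * (a 1 / real CARD('n) + a 0) - real N * majorant DIM('k) CARD('n) a 1"
proof -
  let ?h = "majorant DIM('k) CARD('n) a"
  define r where "r i = norm (y i)" for i
  \<comment> \<open>A zero vector gets an arbitrary unit direction. Its weight \<open>w i\<close> is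
    \<open>0\<close>, while \<open>t i i = 1\<close> and the bounds on \<open>t\<close> stay
    valid.\<close>
  define e where "e i = (if y i = 0 then axis undefined 1 else y i /\<^sub>R r i)" for i
  define t where "t i j = norm (hinner (e i) (e j))" for i j
  define w where "w i = r i powr q" for i
  have r: "r i \<ge> 0" for i
    by (simp add: r_def)
  have e: "norm (e i) = 1" for i
    using norm_one[where 'a='k, unfolded norm_eq_sqrt_inner]
    by (cases "y i = 0") (simp_all add: e_def r_def norm_eq_sqrt_inner[of "axis _ _"] inner_axis_axis)
  have y: "y i = norm (y i) *\<^sub>R e i" for i
    by (simp add: e_def r_def)
  have t: "t i j \<in> {0..1}" for i j
    using norm_hinner_le[of "e i" "e j"] e by (simp add: t_def)
  have t1: "t i i = 1" for i
    by (simp add: t_def hinner_self e)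
  have h: "u powr q \<le> ?h u" if "u \<in> {0..1}" for u
    using maj that by (simp add: powr_majorized_def)
  have h1: "?h 1 \<ge> 0"
    using h[of 1] by simp
  have sum_r: "(\<Sum>i=1..N. (r i)\<^sup>2) = real N"
    using sum_norm_sq_tight_frame[OF frame] by (simp add: r_def)
  have r2: "(r i)\<^sup>2 powr p = r i powr (2 * p)" for i p
    using r[of i] by (cases "r i = 0") (simp_all add: powr_powr flip: powr_numeral)
  have sum_affine: "(\<Sum>i=1..N. 1 + c * ((r i)\<^sup>2 - 1)) = real N" for c
    by (simp only: sum.distrib sum_subtractf sum_r flip: sum_distrib_left) simp
  have sum_w: "(\<Sum>i=1..N. w i) \<le> real N"
  proof -
    have "(\<Sum>i=1..N. w i) \<le> (\<Sum>i=1..N. 1 + q / 2 * ((r i)\<^sup>2 - 1))"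
    proof (intro sum_mono)
      show "w i \<le> 1 + q / 2 * ((r i)\<^sup>2 - 1)" for i
        using powr_le_affine[of "(r i)\<^sup>2" "q / 2"] q by (simp add: r2 w_def)
    qed
    also have "\<dots> = real N"
      by (rule sum_affine)
    finally show ?thesis .
  qed
  have sum_w2: "(\<Sum>i=1..N. (w i)\<^sup>2) \<ge> real N"
  proof -
    have "real N = (\<Sum>i=1..N. 1 + q * ((r i)\<^sup>2 - 1))"
      by (rule sum_affine[symmetric])
    also have "\<dots> \<le> (\<Sum>i=1..N. (w i)\<^sup>2)"
    proof (intro sum_mono)
      have "(w i)\<^sup>2 = (r i)\<^sup>2 powr q" for i
        using r by (simp add: w_def power2_eq_square powr_mult)
      then show "1 + q * ((r i)\<^sup>2 - 1) \<le> (w i)\<^sup>2" for i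
        using powr_ge_affine[of "(r i)\<^sup>2" q] q by simp
    qed
    finally show ?thesis .
  qed
  have "norm (hinner (y i) (y j)) powr q \<le> w i * w j * ?h (t i j)" for i j
  proof -
    have "norm (hinner (y i) (y j)) = r i * r j * t i j"
      by (subst y[of i], subst y[of j]) (simp add: r_def t_def hinner_scaleR_left hinner_scaleR_right)
    then have "norm (hinner (y i) (y j)) powr q = w i * w j * t i j powr q"
      using r t by (simp add: w_def powr_mult)
    also have "\<dots> \<le> w i * w j * ?h (t i j)"
      using h[OF t] by (intro mult_left_mono) (auto simp: w_def)
    finally show ?thesis .
  qed
  then have "(\<Sum>i\<in>{1..N}. \<Sum>j\<in>{1..N} - {i}. norm (hinner (y i) (y j)) powr q)
      \<le> (\<Sum>i\<in>{1..N}. \<Sum>j\<in>{1..N} - {i}. w i * w j * ?h (t i j))"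
    by (intro sum_mono)
  \<comment> \<open>The diagonal is restored because positive definiteness concerns the full double
    sum; it is subtracted again with \<open>t i i = 1\<close>.\<close>
  also have "\<dots> = (\<Sum>i=1..N. \<Sum>j=1..N. w i * w j * ?h (t i j)) - (\<Sum>i=1..N. (w i)\<^sup>2) * ?h 1"
    by (simp add: sum_off_diagonal t1 sum_distrib_right power2_eq_square)
  \<comment> \<open>The diagonal enters with a minus sign, so it needs the lower bound
    \<open>sum_w2\<close> and \<open>h1\<close>; the full sum uses the upper bounds and
    \<open>a 0, a 1 \<ge> 0\<close>.\<close>
  also have "\<dots> \<le> (a 0 * (real N)\<^sup>2 + a 1 * ((real N)\<^sup>2 / real CARD('n))) - real N * ?h 1"
  proof (intro diff_mono mult_right_mono sum_w2 h1)
    have "(\<Sum>i=1..N. \<Sum>j=1..N. w i * w j * ?h (t i j)) \<le>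
       a 0 * (\<Sum>i=1..N. w i)\<^sup>2 + a 1 * (\<Sum>i=1..N. \<Sum>j=1..N. w i * w j * (t i j)\<^sup>2)"
      unfolding t_def by (intro sum_majorant_le[OF d _ _ a(3) maj] e) auto
    also have "\<dots> \<le> a 0 * (real N)\<^sup>2 + a 1 * ((real N)\<^sup>2 / real CARD('n))"
    proof (intro add_mono mult_left_mono a power_mono sum_w)
      show "(\<Sum>i=1..N. \<Sum>j=1..N. w i * w j * (t i j)\<^sup>2) \<le> (real N)\<^sup>2 / real CARD('n)"
        unfolding w_def r_def t_def by (rule tight_frame_weighted_sum_le[OF q frame e y])
    qed (simp add: w_def sum_nonneg)
    finally show "(\<Sum>i=1..N. \<Sum>j=1..N. w i * w j * ?h (t i j)) \<le>
      a 0 * (real N)\<^sup>2 + a 1 * ((real N)\<^sup>2 / real CARD('n))" .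
  qed
  also have "\<dots> = (real N)\<^sup>2 * (a 1 / real CARD('n) + a 0) - real N * ?h 1"
    by (simp add: algebra_simps)
  finally show ?thesis .
qed

theorem corollary3:
  fixes q :: real and a :: "nat \<Rightarrow> real"
  assumes "2 \<le> CARD('d::finite)" and "1 \<le> q" and "q \<le> 2"
    and "0 \<le> a 0" and "0 \<le> a 1" and "\<And>k. 2 \<le> k \<Longrightarrow> a k \<le> 0"
  shows "(powr_majorized DIM(real) CARD('d) q a \<longrightarrow>
      (\<forall>(N::nat) (y :: nat \<Rightarrow> real ^ 'd). tight_frame N y (real N / real CARD('d)) \<longrightarrow>
        (\<Sum>i\<in>{1..N}. \<Sum>j\<in>{1..N} - {i}. norm (hinner (y i) (y j)) powr q)
          \<le> (real N)\<^sup>2 * (a 1 / real CARD('d) + a 0) - real N * majorant DIM(real) CARD('d) a 1)) \<and>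
    (powr_majorized DIM(complex) CARD('d) q a \<longrightarrow>
      (\<forall>(N::nat) (y :: nat \<Rightarrow> complex ^ 'd). tight_frame N y (real N / real CARD('d)) \<longrightarrow>
        (\<Sum>i\<in>{1..N}. \<Sum>j\<in>{1..N} - {i}. norm (hinner (y i) (y j)) powr q)
          \<le> (real N)\<^sup>2 * (a 1 / real CARD('d) + a 0) - real N * majorant DIM(complex) CARD('d) a 1)) \<and>
    (powr_majorized DIM(quat) CARD('d) q a \<longrightarrow>
      (\<forall>(N::nat) (y :: nat \<Rightarrow> quat ^ 'd). tight_frame N y (real N / real CARD('d)) \<longrightarrow>
        (\<Sum>i\<in>{1..N}. \<Sum>j\<in>{1..N} - {i}. norm (hinner (y i) (y j)) powr q)
          \<le> (real N)\<^sup>2 * (a 1 / real CARD('d) + a 0) - real N * majorant DIM(quat) CARD('d) a 1))"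
  using assms
  \<comment> \<open>The conjuncts are instances of the class-generic bound at \<open>real\<close>,
    \<open>complex\<close> and \<open>quat\<close>.\<close>
  by (intro conjI impI allI tight_frame_powr_sum_le)

end
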